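(* Let $N\ge 1$ and $b\ge 1$ be integers and let $c>0$. The pseudo-distribution of $(\sigma_b^+,S_b^+)$ is characterized by the following identity, valid for any $z\in(0,1)$ and any $\ell\in\{b,b+1,\dots,b+N-1\}$: $$\mathbb{E}\!\left(z^{\sigma_b^+}1_{\{S_b^+=\ell,\ \sigma_b^+<+\infty\}}\right)=(-1)^{\ell-b}\sum_{k=1}^N\frac{s_{k,\ell-b}^+(z)}{p_k^+(z)}\,u_k(z)^{b+N-1},$$ where $s_{k,0}^+(z)=1$ and, for $k\in\{1,\dots,N\}$ and $m\in\{1,\dots,N-1\}$, $$s_{k,m}^+(z)=\sum_{\substack{1\le i_1<\dots<i_m\le N\\ i_1,\dots,i_m\ne k}}u_{i_1}(z)\cdots u_{i_m}(z),\qquad p_k^+(z)=\prod_{\substack{1\le j\le N\\ j\ne k}}[u_k(z)-u_j(z)].$$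
   Context: Pseudo-random walk: put $p_k=\delta_{k0}+(-1)^{k-1}c\binom{2N}{k+N}$ for $k\in\{-N,\dots,N\}$ (real numbers, possibly negative, summing to $1$). The $U_n$, $n\ge1$, are independent identically distributed pseudo-random variables (measurable functions on a space endowed with a signed measure of total mass one) with $\mathbb{P}\{U_n=k\}=p_k$, so that $\mathbb{P}\{U_1=k_1,\dots,U_n=k_n\}=p_{k_1}\cdots p_{k_n}$; $S_0=0$, $S_n=U_1+\dots+U_n$. First overshooting time: $\sigma_b^+=\min\{n\ge1:S_n\ge b\}$ ($\min\emptyset=+\infty$), and, when $\sigma_b^+<+\infty$, $S_b^+=S_{\sigma_b^+}\in\{b,\dots,b+N-1\}$. Here $\mathbb{P}\{\sigma_b^+=k,S_b^+=\ell\}=\mathbb{P}\{S_1<b,\dots,S_{k-1}<b,S_k=\ell\}$ for $k\ge1$. Generating function: $\mathbb{E}\big(z^{\sigma_b^+}1_{\{S_b^+=\ell,\sigma_b^+<+\infty\}}\big)=\sum_{k\ge1}\mathbb{P}\{\sigma_b^+=k,S_b^+=\ell\}z^k$. Roots: for $z\in(0,1)$ and $1\le j\le N$, let $\theta_j=-\mathrm{e}^{\mathrm{i}\frac{2j-1}{N}\pi}$ and $w(z)=\frac12\sqrt[N]{1-z}\,/\sqrt[N]{cz}$. The equation $u^2-2[1+\theta_jw(z)]u+1=0$ has two mutually inverse roots, exactly one of which has modulus $<1$; it is denoted $u_j(z)$. Equivalently, $u_1(z),\dots,u_N(z)$ are the roots in the open unit disc of the polynomial $(1-z)u^N-(-1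)^{N-1}cz(u-1)^{2N}$.
   Formalization: For c > 2^(1-2N) the series defining the expectation diverges for some z in (0,1); at such z the expectation is read as the analytic continuation of the series along [0,z]. Wherever the series converges (proved for z(4^N c - 1) < 1) the identity is literal. *)

theory Defs
  imports "HOL-Analysis.Analysis"
begin

section \<open>The pseudo-random walk\<close>

definition step_prob :: "nat \<Rightarrow> real \<Rightarrow> int \<Rightarrow> real" where
  "step_prob N c k =
     (if k = 0 then 1 else 0) + (-1) powi (k - 1) * c * real ((2 * N) choose nat (k + int N))"

text \<open>
  The canonical realisation is used: \<^term>\<open>\<omega> n\<close> is the value of the step $U_n$ for $n \ge 1$ (the
  value \<^term>\<open>\<omega> 0\<close> plays no role).
\<close>

definition path_space :: "nat \<Rightarrow> (nat \<Rightarrow> int) set" where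
  "path_space N = {1..} \<rightarrow> {- int N..int N}"

definition walk :: "(nat \<Rightarrow> int) \<Rightarrow> nat \<Rightarrow> int" where
  "walk \<omega> n = (\<Sum>i=1..n. \<omega> i)"

definition cylinder :: "nat \<Rightarrow> nat \<Rightarrow> (nat \<Rightarrow> int) \<Rightarrow> (nat \<Rightarrow> int) set" where
  "cylinder N n v = {\<omega> \<in> path_space N. \<forall>i\<in>{1..n}. \<omega> i = v i}"

text \<open>
  The pseudo-probability of an event \<^term>\<open>A\<close> that is determined by the first \<^term>\<open>n\<close> steps, i.e.\ that is a
  union of cylinders of length \<^term>\<open>n\<close>. Only such events carry a pseudo-probability: for
  $\sum_k |p_k| > 1$ the infinite product is not a measure of finite variation.
\<close>

definition pseudo_prob :: "nat \<Rightarrow> real \<Rightarrow> nat \<Rightarrow> (nat \<Rightarrow> int) set \<Rightarrow> real" where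
  "pseudo_prob N c n A =
     (\<Sum>v | v \<in> {1..n} \<rightarrow>\<^sub>E {- int N..int N} \<and> cylinder N n v \<subseteq> A. \<Prod>i=1..n. step_prob N c (v i))"

section \<open>First overshooting time and place\<close>

definition overshoot_time :: "int \<Rightarrow> (nat \<Rightarrow> int) \<Rightarrow> enat" where
  "overshoot_time b \<omega> = Inf (enat ` {n. 1 \<le> n \<and> b \<le> walk \<omega> n})"

text \<open>Meaningful only where the overshooting time is finite.\<close>

definition overshoot_place :: "int \<Rightarrow> (nat \<Rightarrow> int) \<Rightarrow> int" where
  "overshoot_place b \<omega> = walk \<omega> (the_enat (overshoot_time b \<omega>))"

definition overshoot_prob :: "nat \<Rightarrow> real \<Rightarrow> int \<Rightarrow> nat \<Rightarrow> int \<Rightarrow> real" where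
  "overshoot_prob N c b k l =
     pseudo_prob N c k
       {\<omega> \<in> path_space N. overshoot_time b \<omega> = enat k \<and> overshoot_place b \<omega> = l}"

lemma overshoot_event_eq:
  assumes "1 \<le> k" "b \<le> l"
  shows "{\<omega> \<in> path_space N. overshoot_time b \<omega> = enat k \<and> overshoot_place b \<omega> = l} =
         {\<omega> \<in> path_space N. (\<forall>j\<in>{1..<k}. walk \<omega> j < b) \<and> walk \<omega> k = l}"
proof -
  have "overshoot_time b \<omega> = enat k \<and> overshoot_place b \<omega> = l \<longleftrightarrow>
        (\<forall>j\<in>{1..<k}. walk \<omega> j < b) \<and> walk \<omega> k = l" (is "?L \<longleftrightarrow> ?R") for \<omega>
  proof
    assume L: ?L
    then have t: "overshoot_time b \<omega> = enat k" and p: "walk \<omega> k = l"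
      by (auto simp: overshoot_place_def)
    have "walk \<omega> j < b" if "j \<in> {1..<k}" for j
    proof (rule ccontr)
      assume "\<not> walk \<omega> j < b"
      then have "enat j \<in> enat ` {n. 1 \<le> n \<and> b \<le> walk \<omega> n}"
        using that by auto
      then have "overshoot_time b \<omega> \<le> enat j"
        unfolding overshoot_time_def by (rule Inf_lower)
      then show False using t that by auto
    qed
    with p show ?R by blast
  next
    assume R: ?R
    have "overshoot_time b \<omega> = enat k"
      unfolding overshoot_time_def
    proof (rule antisym)
      show "Inf (enat ` {n. 1 \<le> n \<and> b \<le> walk \<omega> n}) \<le> enat k"
        using R assms by (intro Inf_lower) auto
      show "enat k \<le> Inf (enat ` {n. 1 \<le> n \<and> b \<le> walk \<omega> n})"
        using R by (intro Inf_greatest) (force simp: not_less[symmetric])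
    qed
    with R show ?L by (simp add: overshoot_place_def)
  qed
  then show ?thesis by blast
qed

section \<open>Generating functions on the interval (0,1)\<close>

text \<open>
  The pseudo-probabilities need not be bounded, so \<^term>\<open>\<Sum>k. a (Suc k) * z ^ Suc k\<close> may diverge
  at some $z \in (0,1)$. There the generating function stands for the analytic continuation
  of the sum of the power series along the segment from $0$ to $z$; its value is unique.
\<close>

definition continued_value :: "(nat \<Rightarrow> real) \<Rightarrow> real \<Rightarrow> complex \<Rightarrow> bool" where
  "continued_value a z v \<longleftrightarrow>
     (\<exists>S f r. open S \<and> connected S \<and> closed_segment 0 (complex_of_real z) \<subseteq> S \<and>
        f holomorphic_on S \<and> r > 0 \<and>
        (\<forall>x\<in>ball 0 r. (\<lambda>k. complex_of_real (a (Suc k)) * x ^ Suc k) sums f x) \<and>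
        f (complex_of_real z) = v)"

definition gen_fun :: "(nat \<Rightarrow> real) \<Rightarrow> real \<Rightarrow> complex" where
  "gen_fun a z =
     (if summable (\<lambda>k. a (Suc k) * z ^ Suc k)
      then complex_of_real (\<Sum>k. a (Suc k) * z ^ Suc k)
      else (THE v. continued_value a z v))"

section \<open>The roots of modulus less than one\<close>

definition theta :: "nat \<Rightarrow> nat \<Rightarrow> complex" where
  "theta N j = - exp (\<i> * of_real ((2 * real j - 1) / real N * pi))"

definition w_fun :: "nat \<Rightarrow> real \<Rightarrow> real \<Rightarrow> real" where
  "w_fun N c z = 1 / 2 * root N (1 - z) / root N (c * z)"

definition u_root :: "nat \<Rightarrow> real \<Rightarrow> real \<Rightarrow> nat \<Rightarrow> complex" where
  "u_root N c z j =
     (THE u. u ^ 2 - 2 * (1 + theta N j * of_real (w_fun N c z)) * u + 1 = 0 \<and> norm u < 1)"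

text \<open>The tuples $i_1 < \dots < i_m$ avoiding $k$ are encoded as $m$-element subsets.\<close>

definition s_plus :: "nat \<Rightarrow> real \<Rightarrow> real \<Rightarrow> nat \<Rightarrow> nat \<Rightarrow> complex" where
  "s_plus N c z k m = (\<Sum>I | I \<subseteq> {1..N} - {k} \<and> card I = m. \<Prod>i\<in>I. u_root N c z i)"

definition p_plus :: "nat \<Rightarrow> real \<Rightarrow> real \<Rightarrow> nat \<Rightarrow> complex" where
  "p_plus N c z k = (\<Prod>j\<in>{1..N} - {k}. u_root N c z k - u_root N c z j)"

end

theory Submission
  imports Defs "HOL-Complex_Analysis.Complex_Analysis"
begin

text \<open>
  Write $p(u) = \sum_k p_k u^k = 1 - c (2 - u - 1/u)^N$ for the symbol of the walk, and $H_l(z)$ for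
  the generating function $\sum_{n \ge 1} P(\sigma = n, S = l) z^n$ of the first overshoot. If $z p(v) = 1$
  and $|v| > 1$, then $z^n v^{S_n}$ is a martingale, at least formally, and stopping it at the
  overshooting time gives $\sum_l H_l(z) v^l = 1$ (\<open>overshoot_optional_stopping\<close>). The equation
  $z p(v) = 1$ is solved by $v = 1/u_k(z)$ for $k = 1, \dots, N$, so there are $N$ linear equations for
  the $N$ unknowns $H_b, \dots, H_{b+N-1}$. Multiplied by $u_k^{b+N-1}$ they say that the $H_l$ are the
  coefficients of the polynomial of degree below $N$ that interpolates $u^{b+N-1}$ at the nodes
  $u_1, \dots, u_N$; Lagrange's formula and Vieta's formulas then give exactly the right-hand side of
  the theorem (\<open>interpolation_coefficient\<close>).

  Two analytic points need care, because the weights $p_k$ are signed. On the unit circle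
  $p = 1 - c (2 - 2 \cos t)^N$ is real with values in $[1 - 4^N c, 1]$, so its modulus is at most
  $\Lambda = \max(1, 4^N c - 1)$. The sum of all $|p_k|$, which governs term-by-term estimates of path
  sums, exceeds $\Lambda$ when $N \ge 2$ and $c$ is small, and would justify the stopping argument only
  for a smaller range of $z$ than claimed. By Parseval, however, one step of the walk
  multiplies the $\ell^2$-norm by at most $\Lambda$, and killing the mass at or above $b$ does not
  increase it. So the mass of the killed walk at time $n$ is at most $\Lambda^n$ at each site
  (\<open>abs_survival_mass_le\<close>), and the series and the stopping argument are available for all complex $z$
  with $|z| \Lambda < 1$. This is the stated range of summability.

  For the remaining $z \in (0,1)$ the value comes from analytic continuation. The root $u_j$ is the
  inverse Joukowski map, holomorphic off $[-1,1]$, applied to $1 + \theta_j w(z)$, and this argument avoids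
  $[-1,1]$ on the whole strip $0 < \mathrm{Re}\, z < 1$: otherwise $1/z$ would be a value $p(u)$ with
  $|u| = 1$, hence a real number at most 1. So the right-hand side is holomorphic on the strip, agrees
  with the power series where the strip meets the disc of radius $1/\Lambda$, and the two together define
  a function on a connected neighbourhood of $[0,1)$. Where the series happens to converge outside the
  disc, Abel's limit theorem identifies its sum with the continued value.
\<close>

section \<open>The walk killed above the barrier\<close>

definition step_conv :: "nat \<Rightarrow> real \<Rightarrow> (int \<Rightarrow> real) \<Rightarrow> int \<Rightarrow> real" where
  "step_conv N c q x = (\<Sum>k\<in>{- int N..int N}. step_prob N c k * q (x - k))"

text \<open>
  Mass that the walk carries at \<^term>\<open>x\<close> after \<^term>\<open>n\<close> steps along paths that have stayed
  below \<^term>\<open>b\<close>: one convolution with the step weights, then truncation. The start at $0$ is not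
  tested against the barrier, which is harmless for \<^term>\<open>1 \<le> b\<close>.
\<close>

primrec survival_mass :: "nat \<Rightarrow> real \<Rightarrow> int \<Rightarrow> nat \<Rightarrow> int \<Rightarrow> real" where
  "survival_mass N c b 0 x = (if x = 0 then 1 else 0)"
| "survival_mass N c b (Suc n) x =
     (if x < b then step_conv N c (survival_mass N c b n) x else 0)"

lemma sum_PiE_Suc:
  assumes "finite I"
  shows "(\<Sum>v\<in>{1..Suc n} \<rightarrow>\<^sub>E I. f v) = (\<Sum>k\<in>I. \<Sum>v\<in>{1..n} \<rightarrow>\<^sub>E I. f (v(Suc n := k)))"
proof -
  have inj: "inj_on (\<lambda>(y, g). g(Suc n := y)) (I \<times> ({1..n} \<rightarrow>\<^sub>E I))"
    by (rule inj_combinator) simp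
  have "(\<Sum>v\<in>{1..Suc n} \<rightarrow>\<^sub>E I. f v) =
      sum f ((\<lambda>(y, g). g(Suc n := y)) ` (I \<times> ({1..n} \<rightarrow>\<^sub>E I)))"
    by (simp add: atLeastAtMostSuc_conv PiE_insert_eq)
  also have "\<dots> = (\<Sum>k\<in>I. \<Sum>v\<in>{1..n} \<rightarrow>\<^sub>E I. f (v(Suc n := k)))"
    unfolding sum.reindex[OF inj] by (simp add: sum.cartesian_product o_def case_prod_beta)
  finally show ?thesis .
qed

lemma walk_upd: "j \<le> n \<Longrightarrow> walk (v(Suc n := k)) j = walk v j"
  unfolding walk_def by (rule sum.cong) auto

lemma walk_upd_Suc: "walk (v(Suc n := k)) (Suc n) = walk v n + k"
  using walk_upd[of n n v k] unfolding walk_def by simp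

text \<open>
  Conditioning on the last step: a path sum in which only the first \<^term>\<open>n\<close> positions are constrained
  is a convolution. It serves both for the surviving mass (truncate afterwards) and for the overshoot
  (evaluate at or above the barrier).
\<close>

lemma path_sum_Suc:
  assumes surv: "\<And>x. q x = (\<Sum>v\<in>{1..n} \<rightarrow>\<^sub>E {- int N..int N}.
      if (\<forall>j\<in>{1..n}. walk v j < b) \<and> walk v n = x
      then \<Prod>i=1..n. step_prob N c (v i) else 0)"
  shows "(\<Sum>v\<in>{1..Suc n} \<rightarrow>\<^sub>E {- int N..int N}.
      if (\<forall>j\<in>{1..n}. walk v j < b) \<and> walk v (Suc n) = y
      then \<Prod>i=1..Suc n. step_prob N c (v i) else 0) = step_conv N c q y"
proof -
  have pr: "(\<Prod>i=1..Suc n. step_prob N c ((v(Suc n := k)) i)) =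
      step_prob N c k * (\<Prod>i=1..n. step_prob N c (v i))" for v k
    by (simp add: mult.commute)
  have cond: "((\<forall>j\<in>{1..n}. walk (v(Suc n := k)) j < b) \<and> walk (v(Suc n := k)) (Suc n) = y) \<longleftrightarrow>
      ((\<forall>j\<in>{1..n}. walk v j < b) \<and> walk v n = y - k)" for v k
    unfolding walk_upd_Suc by (auto simp: walk_upd)
  show ?thesis
    unfolding step_conv_def surv
    by (subst sum_PiE_Suc, simp, unfold cond pr)
       (simp add: sum_distrib_left if_distrib[of "\<lambda>t. _ * t"] cong: if_cong)
qed

lemma survival_mass_eq_path_sum:
  assumes "1 \<le> b"
  shows "survival_mass N c b n x = (\<Sum>v\<in>{1..n} \<rightarrow>\<^sub>E {- int N..int N}.
      if (\<forall>j\<in>{1..n}. walk v j < b) \<and> walk v n = x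
      then \<Prod>i=1..n. step_prob N c (v i) else 0)"
proof (induction n arbitrary: x)
  case 0
  then show ?case by (auto simp: walk_def)
next
  case (Suc n)
  have cond: "(\<forall>j\<in>{1..Suc n}. walk v j < b) \<and> walk v (Suc n) = x \<longleftrightarrow>
      x < b \<and> (\<forall>j\<in>{1..n}. walk v j < b) \<and> walk v (Suc n) = x" for v
    by (auto simp: le_Suc_eq)
  show ?case
  proof (cases "x < b")
    case True
    then show ?thesis
      using path_sum_Suc[OF Suc.IH, where y = x] unfolding cond by simp
  next
    case False
    then show ?thesis unfolding cond by simp
  qed
qed

text \<open>
  The event depends on the first \<^term>\<open>n\<close> steps only, and a cylinder is never empty: its prescribed
  steps can be prolonged by zeros. So inclusion of the cylinder can be read off from the prescribed steps.
\<close>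

lemma cylinder_subset_overshoot_event_iff:
  assumes "v \<in> {1..n} \<rightarrow>\<^sub>E {- int N..int N}"
  shows "cylinder N n v \<subseteq> {\<omega> \<in> path_space N. (\<forall>j\<in>{1..<n}. walk \<omega> j < b) \<and> walk \<omega> n = l} \<longleftrightarrow>
     (\<forall>j\<in>{1..<n}. walk v j < b) \<and> walk v n = l" (is "_ \<subseteq> ?A \<longleftrightarrow> ?C v")
proof -
  have eq: "walk \<omega> j = walk v j" if "\<omega> \<in> cylinder N n v" "j \<le> n" for \<omega> j
    using that unfolding walk_def cylinder_def by (intro sum.cong) auto
  have same: "?C \<omega> \<longleftrightarrow> ?C v" if "\<omega> \<in> cylinder N n v" for \<omega>
    using eq[OF that] by auto
  define \<omega> where "\<omega> = (\<lambda>i. if i \<in> {1..n} then v i else 0)"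
  have mem: "\<omega> \<in> cylinder N n v"
    using assms by (auto simp: \<omega>_def cylinder_def path_space_def)
  show ?thesis
  proof
    assume "cylinder N n v \<subseteq> ?A"
    then have "?C \<omega>" using mem by blast
    then show "?C v" using same[OF mem] by blast
  next
    assume "?C v"
    show "cylinder N n v \<subseteq> ?A"
    proof
      fix \<eta> assume \<eta>: "\<eta> \<in> cylinder N n v"
      then have "?C \<eta>" using same[OF \<eta>] \<open>?C v\<close> by blast
      moreover have "\<eta> \<in> path_space N" using \<eta> by (simp add: cylinder_def)
      ultimately show "\<eta> \<in> ?A" by blast
    qed
  qed
qed

lemma overshoot_prob_Suc:
  assumes "1 \<le> b" "b \<le> l"
  shows "overshoot_prob N c b (Suc n) l = step_conv N c (survival_mass N c b n) l"
proof -
  let ?P = "{1..Suc n} \<rightarrow>\<^sub>E {- int N..int N}"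
  let ?C = "\<lambda>v. (\<forall>j\<in>{1..n}. walk v j < b) \<and> walk v (Suc n) = l"
  have fin: "finite ?P" by (intro finite_PiE) auto
  have "{v. v \<in> ?P \<and> cylinder N (Suc n) v \<subseteq> {\<omega> \<in> path_space N. overshoot_time b \<omega> = enat (Suc n)
      \<and> overshoot_place b \<omega> = l}} = {v \<in> ?P. ?C v}"
    using cylinder_subset_overshoot_event_iff[of _ "Suc n" N b l]
    unfolding overshoot_event_eq[of "Suc n", OF _ assms(2), simplified]
    by (auto simp: atLeastLessThanSuc_atLeastAtMost)
  then have "overshoot_prob N c b (Suc n) l = (\<Sum>v\<in>{v \<in> ?P. ?C v}. \<Prod>i=1..Suc n. step_prob N c (v i))"
    unfolding overshoot_prob_def pseudo_prob_def by (rule arg_cong)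
  also have "\<dots> = (\<Sum>v\<in>?P. if ?C v then \<Prod>i=1..Suc n. step_prob N c (v i) else 0)"
    using fin by (rule sum.inter_filter)
  also have "\<dots> = step_conv N c (survival_mass N c b n) l"
    by (rule path_sum_Suc) (rule survival_mass_eq_path_sum[OF assms(1)])
  finally show ?thesis .
qed

section \<open>The symbol of the walk and discrete Fourier analysis\<close>

lemma step_conv_eq_0:
  assumes "\<And>x. \<bar>x\<bar> > int M \<Longrightarrow> q x = 0" and "\<bar>x\<bar> > int (M + N)"
  shows "step_conv N c q x = 0"
  unfolding step_conv_def using assms(2) by (intro sum.neutral) (auto intro!: assms(1))

text \<open>
  The Laurent polynomial of a mass distribution supported in $[-M,M]$; on the unit circle it is the
  Fourier transform.
\<close>

definition laurent :: "nat \<Rightarrow> (int \<Rightarrow> real) \<Rightarrow> complex \<Rightarrow> complex" where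
  "laurent M q t = (\<Sum>x\<in>{- int M..int M}. of_real (q x) * t powi x)"

definition symbol :: "nat \<Rightarrow> real \<Rightarrow> complex \<Rightarrow> complex" where
  "symbol N c t = (\<Sum>k\<in>{- int N..int N}. of_real (step_prob N c k) * t powi k)"

text \<open>
  Convolution becomes multiplication. The window has to grow by \<^term>\<open>N\<close> to contain the support of the
  convolution.
\<close>

lemma laurent_step_conv:
  assumes q: "\<And>x. \<bar>x\<bar> > int M \<Longrightarrow> q x = 0" and t: "t \<noteq> 0"
  shows "laurent (M + N) (step_conv N c q) t = symbol N c t * laurent M q t"
proof -
  have shift: "(\<Sum>y\<in>{- int (M + N)..int (M + N)}. of_real (q (y - k)) * t powi (y - k)) = laurent M q t"
    if k: "k \<in> {- int N..int N}" for k
  proof -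
    have "(\<Sum>y\<in>{- int (M + N)..int (M + N)}. of_real (q (y - k)) * t powi (y - k)) =
        (\<Sum>x\<in>{- int (M + N) - k..int (M + N) - k}. of_real (q x) * t powi x)"
      by (rule sum.reindex_bij_witness[of _ "\<lambda>x. x + k" "\<lambda>y. y - k"]) auto
    also have "\<dots> = laurent M q t"
      unfolding laurent_def using k by (intro sum.mono_neutral_right) (auto intro!: q)
    finally show ?thesis .
  qed
  have "laurent (M + N) (step_conv N c q) t =
      (\<Sum>y\<in>{- int (M + N)..int (M + N)}. \<Sum>k\<in>{- int N..int N}.
         of_real (step_prob N c k) * t powi k * (of_real (q (y - k)) * t powi (y - k)))"
    unfolding laurent_def step_conv_def of_real_sum sum_distrib_right
    using t by (intro sum.cong refl) (simp add: power_int_diff)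
  also have "\<dots> = (\<Sum>k\<in>{- int N..int N}. of_real (step_prob N c k) * t powi k * laurent M q t)"
    by (subst sum.swap) (simp only: shift sum_distrib_left[symmetric] cong: sum.cong)
  finally show ?thesis
    by (simp add: symbol_def sum_distrib_right)
qed

text \<open>
  The binomial theorem for $(1-t)^{2N}$, together with $-(1-t)^2/t = 2 - t - 1/t$.
\<close>

lemma symbol_eq:
  assumes "t \<noteq> 0"
  shows "symbol N c t = 1 - of_real c * (2 - t - 1 / t) ^ N"
proof -
  have "(\<Sum>k\<in>{- int N..int N}. (-1) powi (k - 1) * of_nat ((2 * N) choose nat (k + int N)) * t powi k) =
      (\<Sum>j\<le>2 * N. (-1) powi (int j - int N - 1) * of_nat ((2 * N) choose j) * t powi (int j - int N))"
    by (rule sum.reindex_bij_witness[of _ "\<lambda>j. int j - int N" "\<lambda>k. nat (k + int N)"]) auto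
  also have "\<dots> = (\<Sum>j\<le>2 * N. - ((-1 / t) ^ N) * (of_nat ((2 * N) choose j) * (- t) ^ j))"
  proof (rule sum.cong)
    fix j
    have "(-1) powi (int j - int N - 1) = - ((-1) ^ j * (-1) ^ N :: complex)"
      by (cases "even N") (simp_all add: power_int_diff)
    moreover have "t powi (int j - int N) = t ^ j / t ^ N"
      using assms by (simp add: power_int_diff)
    ultimately show "(-1) powi (int j - int N - 1) * of_nat ((2 * N) choose j) * t powi (int j - int N) =
        - ((-1 / t) ^ N) * (of_nat ((2 * N) choose j) * (- t) ^ j)"
      by (simp add: power_divide power_minus[of t] power_minus[of "1 / t"])
  qed simp
  also have "\<dots> = - ((-1 / t) ^ N * (1 - t) ^ (2 * N))"
    using binomial_ring[of "- t" 1 "2 * N"] by (simp add: sum_negf mult.assoc flip: sum_distrib_left)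
  also have "(-1 / t) ^ N * (1 - t) ^ (2 * N) = (2 - t - 1 / t) ^ N"
  proof -
    have "(-1 / t) * (1 - t) ^ 2 = 2 - t - 1 / t"
      using assms by (simp add: power2_eq_square field_simps)
    then show ?thesis by (metis power_mult power_mult_distrib)
  qed
  finally have *: "(\<Sum>k\<in>{- int N..int N}. (-1) powi (k - 1) * of_nat ((2 * N) choose nat (k + int N)) * t powi k) =
      - ((2 - t - 1 / t) ^ N)" .
  have "symbol N c t = (\<Sum>k\<in>{- int N..int N}. (if k = 0 then 1 else 0) +
      of_real c * ((-1) powi (k - 1) * of_nat ((2 * N) choose nat (k + int N)) * t powi k))"
    unfolding symbol_def step_prob_def
    by (intro sum.cong refl) (auto simp: algebra_simps)
  also have "\<dots> = 1 + of_real c * (- ((2 - t - 1 / t) ^ N))"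
    by (simp add: sum.distrib * flip: sum_distrib_left)
  finally show ?thesis by simp
qed

text \<open>
  For $c \ge 0$ this is the maximum of $|p|$ on the unit circle, attained at $1$ or at $-1$; its inverse is
  the radius of the disc on which the power series are handled directly.
\<close>

definition symbol_bound :: "nat \<Rightarrow> real \<Rightarrow> real" where
  "symbol_bound N c = max 1 (4 ^ N * c - 1)"

lemma norm_symbol_le:
  assumes "norm t = 1" "0 \<le> c"
  shows "norm (symbol N c t) \<le> symbol_bound N c"
proof -
  have t0: "t \<noteq> 0" using assms by auto
  have "t * cnj t = 1" using assms by (simp add: complex_norm_square[symmetric])
  then have "1 / t = cnj t" using t0 by (simp add: field_simps)
  moreover have "t + cnj t = of_real (2 * Re t)" by (rule complex_add_cnj)
  ultimately have *: "2 - t - 1 / t = of_real (2 - 2 * Re t)"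
    by (metis diff_diff_eq of_real_diff of_real_numeral)
  have eq: "symbol N c t = of_real (1 - c * (2 - 2 * Re t) ^ N)"
    unfolding symbol_eq[OF t0] * by simp
  have "\<bar>Re t\<bar> \<le> 1" using abs_Re_le_cmod[of t] assms by simp
  then have "0 \<le> (2 - 2 * Re t) ^ N" "(2 - 2 * Re t) ^ N \<le> 4 ^ N"
    by (auto intro!: power_mono)
  then have "0 \<le> c * (2 - 2 * Re t) ^ N" "c * (2 - 2 * Re t) ^ N \<le> 4 ^ N * c"
    using assms(2) by (auto simp: mult.commute intro: mult_left_mono)
  then show ?thesis
    unfolding eq norm_of_real symbol_bound_def by linarith
qed

lemma sum_root_unity_powi:
  assumes "\<bar>d\<bar> < int L"
  shows "(\<Sum>j<L. cis (2 * pi * real j / real L) powi d) = (if d = 0 then of_nat L else 0)"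
proof (cases "d = 0")
  case False
  have L: "L > 0" using assms by linarith
  define \<zeta> where "\<zeta> = cis (2 * pi / real L) powi d"
  have pow: "cis (2 * pi * real j / real L) powi d = \<zeta> ^ j" for j
    unfolding \<zeta>_def cis_power_int Complex.DeMoivre by (rule arg_cong[of _ _ cis]) simp
  have ne: "\<zeta> \<noteq> 1"
  proof
    assume "\<zeta> = 1"
    then have "cos (2 * pi * (of_int d / real L)) = 1"
      by (simp add: \<zeta>_def cis_power_int complex_eq_iff algebra_simps)
    then obtain k :: int where "2 * pi * (of_int d / real L) = of_int k * 2 * pi"
      by (subst (asm) cos_one_2pi_int) (auto simp: mult_ac)
    then have "of_int d = (of_int (k * int L) :: real)"
      using L by (simp add: field_simps)
    then have dk: "d = k * int L" by (simp only: of_int_eq_iff)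
    with False have "\<bar>k\<bar> \<ge> 1" by auto
    then have "\<bar>k\<bar> * int L \<ge> int L" using L by simp
    then show False using dk assms by (simp add: abs_mult)
  qed
  have "\<zeta> ^ L = cis (2 * pi * of_int d)"
    using L by (simp add: \<zeta>_def cis_power_int Complex.DeMoivre mult.commute)
  then have "\<zeta> ^ L = 1" by (simp add: cis_multiple_2pi)
  then show ?thesis
    using False ne by (simp add: pow geometric_sum)
qed (simp)

text \<open>
  The characters $x \mapsto \omega^x$ with $\omega^L = 1$ are orthogonal on any window shorter than \<^term>\<open>L\<close>;
  taking finitely many frequencies keeps the argument free of integrals.
\<close>

lemma discrete_parseval:
  assumes "L > 2 * M"
  shows "(\<Sum>j<L. (norm (laurent M q (cis (2 * pi * real j / real L))))\<^sup>2) =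
     real L * (\<Sum>x\<in>{- int M..int M}. (q x)\<^sup>2)"
proof -
  let ?\<omega> = "\<lambda>j. cis (2 * pi * real j / real L)"
  let ?I = "{- int M..int M}"
  have "of_real ((norm (laurent M q (?\<omega> j)))\<^sup>2) =
      (\<Sum>x\<in>?I. \<Sum>y\<in>?I. of_real (q x * q y) * ?\<omega> j powi (x - y))" for j
  proof -
    \<comment> \<open>On the unit circle conjugation inverts, which turns the squared modulus into a double sum over differences.\<close>
    have cn: "cnj (?\<omega> j powi y) = ?\<omega> j powi (- y)" for y
      by (simp add: cis_power_int cis_cnj)
    show ?thesis
      unfolding complex_norm_square laurent_def cnj_sum sum_product complex_cnj_mult cn
      by (intro sum.cong refl) (simp add: power_int_diff power_int_minus field_simps)
  qed
  then have "of_real (\<Sum>j<L. (norm (laurent M q (?\<omega> j)))\<^sup>2) =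
      (\<Sum>j<L. \<Sum>x\<in>?I. \<Sum>y\<in>?I. of_real (q x * q y) * ?\<omega> j powi (x - y))"
    by simp
  also have "\<dots> = (\<Sum>x\<in>?I. \<Sum>j<L. \<Sum>y\<in>?I. of_real (q x * q y) * ?\<omega> j powi (x - y))"
    by (rule sum.swap)
  also have "\<dots> = (\<Sum>x\<in>?I. \<Sum>y\<in>?I. of_real (q x * q y) * (\<Sum>j<L. ?\<omega> j powi (x - y)))"
    by (subst sum.swap) (simp add: sum_distrib_left)
  also have "\<dots> = (\<Sum>x\<in>?I. \<Sum>y\<in>?I. of_real (q x * q y) * (if y = x then of_nat L else 0))"
  proof (intro sum.cong refl)
    fix x y assume "x \<in> ?I" "y \<in> ?I"
    then have "\<bar>x - y\<bar> < int L" using assms by auto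
    then show "of_real (q x * q y) * (\<Sum>j<L. ?\<omega> j powi (x - y)) =
        of_real (q x * q y) * (if y = x then of_nat L else (0::complex))"
      by (subst sum_root_unity_powi) auto
  qed
  also have "\<dots> = of_real (real L * (\<Sum>x\<in>?I. (q x)\<^sup>2))"
    by (simp add: if_distrib[of "\<lambda>t. _ * t"] sum_distrib_left power2_eq_square mult_ac cong: if_cong)
  finally show ?thesis by (simp only: of_real_eq_iff)
qed

text \<open>
  In Fourier space a step is multiplication by the symbol, so its operator norm on $\ell^2$ is the
  supremum of the symbol on the circle. The sum of the absolute values of the weights,
  which bounds it too, can be larger.
\<close>

lemma step_conv_l2_bound:
  assumes q: "\<And>x. \<bar>x\<bar> > int M \<Longrightarrow> q x = 0" and c: "0 \<le> c"
  shows "(\<Sum>x\<in>{- int (M + N)..int (M + N)}. (step_conv N c q x)\<^sup>2) \<le>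
     (symbol_bound N c)\<^sup>2 * (\<Sum>x\<in>{- int M..int M}. (q x)\<^sup>2)"
proof -
  define L where "L = 2 * (M + N) + 1"
  let ?\<omega> = "\<lambda>j. cis (2 * pi * real j / real L)"
  have "real L * (\<Sum>x\<in>{- int (M + N)..int (M + N)}. (step_conv N c q x)\<^sup>2) =
      (\<Sum>j<L. (norm (laurent (M + N) (step_conv N c q) (?\<omega> j)))\<^sup>2)"
    by (rule discrete_parseval[symmetric]) (simp add: L_def)
  also have "\<dots> = (\<Sum>j<L. (norm (symbol N c (?\<omega> j)))\<^sup>2 * (norm (laurent M q (?\<omega> j)))\<^sup>2)"
    by (subst laurent_step_conv[OF q]) (auto simp: norm_mult power_mult_distrib)
  also have "\<dots> \<le> (\<Sum>j<L. (symbol_bound N c)\<^sup>2 * (norm (laurent M q (?\<omega> j)))\<^sup>2)"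
    by (intro sum_mono mult_right_mono power_mono norm_symbol_le c) auto
  also have "\<dots> = (symbol_bound N c)\<^sup>2 * (real L * (\<Sum>x\<in>{- int M..int M}. (q x)\<^sup>2))"
    unfolding sum_distrib_left[symmetric]
    by (subst discrete_parseval[of M L]) (simp_all add: L_def)
  finally show ?thesis by (simp add: L_def mult_ac)
qed

section \<open>Growth of the killed walk and optional stopping\<close>

lemma symbol_bound_ge_1: "1 \<le> symbol_bound N c"
  by (simp add: symbol_bound_def)

lemma survival_mass_eq_0: "\<bar>x\<bar> > int (n * N) \<Longrightarrow> survival_mass N c b n x = 0"
proof (induction n arbitrary: x)
  case (Suc n)
  have "step_conv N c (survival_mass N c b n) x = 0"
    by (rule step_conv_eq_0[where M = "n * N"]) (use Suc in \<open>auto simp: algebra_simps\<close>)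
  then show ?case by simp
qed auto

lemma survival_mass_above: "1 \<le> b \<Longrightarrow> b \<le> x \<Longrightarrow> survival_mass N c b n x = 0"
  by (cases n) auto

lemma survival_mass_l2_bound:
  assumes "0 \<le> c"
  shows "(\<Sum>x\<in>{- int (n * N)..int (n * N)}. (survival_mass N c b n x)\<^sup>2) \<le> (symbol_bound N c ^ n)\<^sup>2"
proof (induction n)
  case (Suc n)
  let ?I = "{- int (n * N + N)..int (n * N + N)}"
  have "(\<Sum>x\<in>?I. (survival_mass N c b (Suc n) x)\<^sup>2) \<le>
      (\<Sum>x\<in>?I. (step_conv N c (survival_mass N c b n) x)\<^sup>2)"
    by (intro sum_mono) simp
  also have "\<dots> \<le> (symbol_bound N c)\<^sup>2 *
      (\<Sum>x\<in>{- int (n * N)..int (n * N)}. (survival_mass N c b n x)\<^sup>2)"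
    by (rule step_conv_l2_bound[OF survival_mass_eq_0 assms])
  also have "\<dots> \<le> (symbol_bound N c)\<^sup>2 * (symbol_bound N c ^ n)\<^sup>2"
    by (intro mult_left_mono Suc.IH) simp
  also have "\<dots> = (symbol_bound N c ^ Suc n)\<^sup>2"
    by (simp add: power_mult_distrib)
  finally show ?case by (simp only: mult_Suc add.commute)
qed simp

text \<open>
  Truncation at the barrier does not increase the $\ell^2$-norm, so the norm grows by at most one factor
  \<^const>\<open>symbol_bound\<close> per step; a single value is bounded by the norm.
\<close>

lemma abs_survival_mass_le:
  assumes "0 \<le> c"
  shows "\<bar>survival_mass N c b n x\<bar> \<le> symbol_bound N c ^ n"
proof (cases "\<bar>x\<bar> > int (n * N)")
  case True
  then show ?thesis
    using survival_mass_eq_0[OF True] symbol_bound_ge_1[of N c] by simp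
next
  case False
  have "(survival_mass N c b n x)\<^sup>2 \<le> (\<Sum>x\<in>{- int (n * N)..int (n * N)}. (survival_mass N c b n x)\<^sup>2)"
    using False by (intro member_le_sum) auto
  also have "\<dots> \<le> (symbol_bound N c ^ n)\<^sup>2"
    by (rule survival_mass_l2_bound[OF assms])
  finally show ?thesis
    using symbol_bound_ge_1[of N c] by (simp add: abs_le_square_iff[symmetric])
qed

lemma abs_overshoot_prob_le:
  assumes "0 \<le> c" "1 \<le> b" "b \<le> l"
  shows "\<bar>overshoot_prob N c b (Suc n) l\<bar> \<le>
     (\<Sum>k\<in>{- int N..int N}. \<bar>step_prob N c k\<bar>) * symbol_bound N c ^ n"
  unfolding overshoot_prob_Suc[OF assms(2,3)] step_conv_def sum_distrib_right
  by (rule order_trans[OF sum_abs])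
     (auto simp: abs_mult intro!: sum_mono mult_left_mono abs_survival_mass_le assms)

lemma summable_overshoot:
  fixes z :: "'a :: {real_normed_field, banach}"
  assumes "0 \<le> c" "1 \<le> b" "b \<le> l" and z: "norm z * symbol_bound N c < 1"
  shows "summable (\<lambda>n. of_real (overshoot_prob N c b (Suc n) l) * z ^ Suc n)"
proof (rule summable_comparison_test')
  let ?C = "\<Sum>k\<in>{- int N..int N}. \<bar>step_prob N c k\<bar>"
  show "summable (\<lambda>n. ?C * norm z * (norm z * symbol_bound N c) ^ n)"
    using z symbol_bound_ge_1[of N c] by (intro summable_mult summable_geometric) (simp add: abs_mult)
  fix n :: nat
  have "norm (of_real (overshoot_prob N c b (Suc n) l) * z ^ Suc n) =
      \<bar>overshoot_prob N c b (Suc n) l\<bar> * norm z ^ Suc n"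
    by (simp add: norm_mult norm_power)
  also have "\<dots> \<le> (?C * symbol_bound N c ^ n) * norm z ^ Suc n"
    by (intro mult_right_mono abs_overshoot_prob_le assms) simp
  finally show "norm (of_real (overshoot_prob N c b (Suc n) l) * z ^ Suc n) \<le>
      ?C * norm z * (norm z * symbol_bound N c) ^ n"
    by (simp add: power_mult_distrib mult_ac)
qed

text \<open>
  The killed walk lives below \<^term>\<open>b\<close>, where $|v|^x$ is summable because $|v| > 1$. Thus the pointwise
  bound on the mass suffices, and the geometric series gives a constant independent of \<^term>\<open>n\<close>.
\<close>

lemma norm_laurent_survival_le:
  assumes "0 \<le> c" "1 \<le> b" "norm v > 1"
  shows "norm (laurent (n * N) (survival_mass N c b n) v) \<le>
     norm v powi b / (norm v - 1) * symbol_bound N c ^ n"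
proof -
  let ?r = "inverse (norm v)"
  have r: "0 < ?r" "?r < 1" using assms(3) by (auto intro: one_less_inverse simp: inverse_less_1_iff)
  let ?I = "{- int (n * N)..<b}"
  have v0: "v \<noteq> 0" using assms(3) by auto
  have "(\<Sum>x\<in>?I. norm v powi x) = (\<Sum>i<nat (b + int (n * N)). norm v powi (b - 1) * ?r ^ i)"
  proof (rule sum.reindex_bij_witness[of _ "\<lambda>i. b - 1 - int i" "\<lambda>x. nat (b - 1 - x)"])
    fix x assume "x \<in> ?I"
    then have "norm v powi (b - 1) = norm v powi x * norm v ^ nat (b - 1 - x)"
      using v0 by (simp add: power_int_add[symmetric] flip: power_int_of_nat)
    then show "norm v powi (b - 1) * ?r ^ nat (b - 1 - x) = norm v powi x"
      using v0 by (simp add: power_inverse)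
  qed auto
  also have "\<dots> \<le> norm v powi (b - 1) * (1 / (1 - ?r))"
    unfolding sum_distrib_left[symmetric]
    using r sum_le_suminf[of "\<lambda>i. ?r ^ i" "{..<nat (b + int (n * N))}"] suminf_geometric[of ?r]
    by (intro mult_left_mono) (auto intro: summable_geometric)
  also have "\<dots> = norm v powi b / (norm v - 1)"
  proof -
    have "norm v powi (b - 1) = norm v powi b / norm v"
      using v0 by (simp add: power_int_diff)
    then show ?thesis using assms(3) v0 by (simp add: field_simps)
  qed
  finally have geo: "(\<Sum>x\<in>?I. norm v powi x) \<le> norm v powi b / (norm v - 1)" .
  have "laurent (n * N) (survival_mass N c b n) v =
      (\<Sum>x\<in>?I. of_real (survival_mass N c b n x) * v powi x)"
    unfolding laurent_def
  proof (rule sum.mono_neutral_cong)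
    fix x assume "x \<in> ?I - {- int (n * N)..int (n * N)}"
    then show "of_real (survival_mass N c b n x) * v powi x = 0"
      by (subst survival_mass_eq_0) auto
  next
    fix x assume "x \<in> {- int (n * N)..int (n * N)} - ?I"
    then show "of_real (survival_mass N c b n x) * v powi x = 0"
      by (subst survival_mass_above[OF assms(2)]) auto
  qed auto
  also have "norm \<dots> \<le> (\<Sum>x\<in>?I. symbol_bound N c ^ n * norm v powi x)"
    by (rule sum_norm_le) (auto simp: norm_mult norm_power_int intro!: mult_right_mono abs_survival_mass_le assms)
  also have "\<dots> \<le> symbol_bound N c ^ n * (norm v powi b / (norm v - 1))"
    unfolding sum_distrib_left[symmetric]
    using symbol_bound_ge_1[of N c] by (intro mult_left_mono geo) simp
  finally show ?thesis by (simp add: mult.commute)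
qed

text \<open>
  Conservation of mass in Laurent form: after one step the mass either survives or lands among the
  \<^term>\<open>N\<close> sites from \<^term>\<open>b\<close> on, since a step has length at most \<^term>\<open>N\<close>.
\<close>

lemma laurent_survival_Suc:
  assumes "1 \<le> b" "v \<noteq> 0"
  shows "symbol N c v * laurent (n * N) (survival_mass N c b n) v =
     laurent (Suc n * N) (survival_mass N c b (Suc n)) v +
     (\<Sum>l\<in>{b..b + int N - 1}. of_real (overshoot_prob N c b (Suc n) l) * v powi l)"
proof -
  define f where "f x = of_real (step_conv N c (survival_mass N c b n) x) * v powi x" for x
  let ?I = "{- int (n * N + N)..int (n * N + N)}"
  have zero: "f x = 0" if "\<bar>x\<bar> > int (n * N + N)" for x
    unfolding f_def using step_conv_eq_0[OF survival_mass_eq_0 that] by simp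
  have far: "f x = 0" if "x \<ge> b + int N" for x
  proof -
    have "step_conv N c (survival_mass N c b n) x = 0"
      unfolding step_conv_def
      using that by (intro sum.neutral ballI) (auto intro!: survival_mass_above assms)
    then show ?thesis by (simp add: f_def)
  qed
  have "symbol N c v * laurent (n * N) (survival_mass N c b n) v = sum f ?I"
    by (subst laurent_step_conv[OF survival_mass_eq_0 assms(2), symmetric]) (auto simp: laurent_def f_def)
  also have "\<dots> = (\<Sum>x\<in>?I. if x < b then f x else 0) + (\<Sum>x\<in>?I. if b \<le> x then f x else 0)"
    by (subst sum.distrib[symmetric]) (auto intro!: sum.cong)
  also have "(\<Sum>x\<in>?I. if x < b then f x else 0) = laurent (Suc n * N) (survival_mass N c b (Suc n)) v"
    unfolding laurent_def by (intro sum.cong) (auto simp: f_def)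
  also have "(\<Sum>x\<in>?I. if b \<le> x then f x else 0) = (\<Sum>l\<in>{b..b + int N - 1}. f l)"
    using zero far by (intro sum.mono_neutral_cong) auto
  finally show ?thesis
    by (simp add: f_def overshoot_prob_Suc[OF assms(1)] del: survival_mass.simps)
qed

text \<open>
  The martingale identity, stopped at the minimum of \<^term>\<open>m\<close> and the overshooting time: because
  $z p(v) = 1$, the mass balance of successive steps telescopes.
\<close>

lemma overshoot_telescope:
  assumes "1 \<le> b" "v \<noteq> 0" "z * symbol N c v = 1"
  shows "(\<Sum>n<m. \<Sum>l\<in>{b..b + int N - 1}. of_real (overshoot_prob N c b (Suc n) l) * z ^ Suc n * v powi l) =
     1 - z ^ m * laurent (m * N) (survival_mass N c b m) v"
proof (induction m)
  case 0
  then show ?case by (simp add: laurent_def)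
next
  case (Suc m)
  have "z ^ m * laurent (m * N) (survival_mass N c b m) v =
      z ^ Suc m * (symbol N c v * laurent (m * N) (survival_mass N c b m) v)"
    using assms(3) by (simp add: mult_ac)
  also have "\<dots> = z ^ Suc m * laurent (Suc m * N) (survival_mass N c b (Suc m)) v +
      (\<Sum>l\<in>{b..b + int N - 1}. of_real (overshoot_prob N c b (Suc m) l) * z ^ Suc m * v powi l)"
    unfolding laurent_survival_Suc[OF assms(1,2)] distrib_left sum_distrib_left
    by (simp add: mult_ac)
  finally show ?case
    using Suc.IH by (simp del: survival_mass.simps)
qed

text \<open>
  The contribution of the paths that have not yet crossed is $O((|z| \Lambda)^m)$, so the stopped identity
  passes to the limit.
\<close>

lemma overshoot_optional_stopping:
  assumes "0 \<le> c" "1 \<le> b" and z: "norm z * symbol_bound N c < 1"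
    and v: "norm v > 1" "z * symbol N c v = 1"
  shows "(\<Sum>l\<in>{b..b + int N - 1}. (\<Sum>n. of_real (overshoot_prob N c b (Suc n) l) * z ^ Suc n) * v powi l) = 1"
proof -
  let ?L = "{b..b + int N - 1}"
  have v0: "v \<noteq> 0" using v by auto
  have "(\<lambda>n. \<Sum>l\<in>?L. of_real (overshoot_prob N c b (Suc n) l) * z ^ Suc n * v powi l) sums
      (\<Sum>l\<in>?L. (\<Sum>n. of_real (overshoot_prob N c b (Suc n) l) * z ^ Suc n) * v powi l)"
    by (intro sums_sum sums_mult2 summable_sums summable_overshoot assms) auto
  then have A: "(\<lambda>m. 1 - z ^ m * laurent (m * N) (survival_mass N c b m) v) \<longlonglongrightarrow>
      (\<Sum>l\<in>?L. (\<Sum>n. of_real (overshoot_prob N c b (Suc n) l) * z ^ Suc n) * v powi l)"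
    unfolding sums_def overshoot_telescope[OF assms(2) v0 v(2)] .
  have "(\<lambda>m. z ^ m * laurent (m * N) (survival_mass N c b m) v) \<longlonglongrightarrow> 0"
  proof (rule Lim_null_comparison)
    let ?C = "norm v powi b / (norm v - 1)"
    show "(\<lambda>m. ?C * (norm z * symbol_bound N c) ^ m) \<longlonglongrightarrow> 0"
      using z symbol_bound_ge_1[of N c]
      by (intro tendsto_mult_right_zero LIMSEQ_power_zero) (simp add: abs_mult)
    show "\<forall>\<^sub>F m in sequentially. norm (z ^ m * laurent (m * N) (survival_mass N c b m) v) \<le>
        ?C * (norm z * symbol_bound N c) ^ m"
    proof (intro always_eventually allI)
      fix m
      have "norm z ^ m * norm (laurent (m * N) (survival_mass N c b m) v) \<le> norm z ^ m * (?C * symbol_bound N c ^ m)"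
        by (intro mult_left_mono norm_laurent_survival_le assms v) simp
      then show "norm (z ^ m * laurent (m * N) (survival_mass N c b m) v) \<le> ?C * (norm z * symbol_bound N c) ^ m"
        by (simp add: norm_mult norm_power power_mult_distrib mult_ac)
    qed
  qed
  then have "(\<lambda>m. 1 - z ^ m * laurent (m * N) (survival_mass N c b m) v) \<longlonglongrightarrow> 1 - 0"
    by (intro tendsto_diff tendsto_const)
  with A show ?thesis using LIMSEQ_unique by fastforce
qed

section \<open>Coefficients of interpolation polynomials\<close>

text \<open>
  Vieta's formulas, read off from the expansion of the product over all subsets.
\<close>

lemma coeff_prod_linear_factors:
  fixes u :: "'a \<Rightarrow> 'b :: comm_ring_1"
  assumes A: "finite A" and m: "m \<le> card A"
  shows "coeff (\<Prod>i\<in>A. [:- u i, 1:]) (card A - m) =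
     (-1) ^ m * (\<Sum>I | I \<subseteq> A \<and> card I = m. \<Prod>i\<in>I. u i)"
proof -
  have "(\<Prod>i\<in>A. [:- u i, 1:]) = (\<Prod>i\<in>A. [:- u i:] + monom 1 1)"
    by (simp add: monom_altdef)
  also have "\<dots> = (\<Sum>X\<in>Pow A. (\<Prod>i\<in>X. [:- u i:]) * (\<Prod>i\<in>A - X. monom 1 1))"
    by (rule prod_add[OF A])
  also have "\<dots> = (\<Sum>X\<in>Pow A. monom (\<Prod>i\<in>X. - u i) (card A - card X))"
  proof (intro sum.cong refl)
    fix X assume "X \<in> Pow A"
    then have X: "finite X" "X \<subseteq> A" using A finite_subset by auto
    have "(\<Prod>i\<in>X. [:- u i:]) = [:\<Prod>i\<in>X. - u i:]"
      using X(1) by (induction X rule: finite_induct) (auto simp: one_pCons)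
    moreover have "(\<Prod>i\<in>A - X. monom (1::'b) 1) = monom 1 (card A - card X)"
      using X by (simp add: monom_power card_Diff_subset)
    ultimately show "(\<Prod>i\<in>X. [:- u i:]) * (\<Prod>i\<in>A - X. monom 1 1) =
        monom (\<Prod>i\<in>X. - u i) (card A - card X)"
      by (simp add: smult_monom)
  qed
  finally have "coeff (\<Prod>i\<in>A. [:- u i, 1:]) (card A - m) =
      (\<Sum>X\<in>Pow A. if card A - card X = card A - m then \<Prod>i\<in>X. - u i else 0)"
    by (simp add: coeff_sum)
  also have "\<dots> = (\<Sum>X | X \<subseteq> A \<and> card X = m. \<Prod>i\<in>X. - u i)"
  proof (rule sum.mono_neutral_cong_right)
    have "card X \<le> card A" if "X \<subseteq> A" for X using A that card_mono by blast
    then have "card A - card X = card A - m \<longleftrightarrow> card X = m" if "X \<subseteq> A" for X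
      using m that by (metis diff_diff_cancel)
    then show "\<forall>X\<in>Pow A - {X. X \<subseteq> A \<and> card X = m}.
        (if card A - card X = card A - m then \<Prod>i\<in>X. - u i else 0) = 0"
      by auto
  qed (use A in auto)
  also have "\<dots> = (\<Sum>X | X \<subseteq> A \<and> card X = m. (-1) ^ m * (\<Prod>i\<in>X. u i))"
    by (intro sum.cong refl) (auto simp: prod_uminus)
  finally show ?thesis by (simp add: sum_distrib_left)
qed

text \<open>
  The hypothesis says that $\sum_i h_i X^{N-1-i}$ takes the values \<^term>\<open>y k\<close> at the nodes \<^term>\<open>u k\<close>. By
  uniqueness it is Lagrange's interpolation polynomial, whose coefficients follow from Vieta's formulas.
\<close>

lemma interpolation_coefficient:
  fixes u :: "nat \<Rightarrow> 'a :: field"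
  assumes inj: "inj_on u {1..N}" and m: "m < N"
    and val: "\<And>k. k \<in> {1..N} \<Longrightarrow> (\<Sum>i<N. h i * u k ^ (N - 1 - i)) = y k"
  shows "h m = (-1) ^ m * (\<Sum>k=1..N.
     (\<Sum>I | I \<subseteq> {1..N} - {k} \<and> card I = m. \<Prod>i\<in>I. u i) /
     (\<Prod>j\<in>{1..N} - {k}. u k - u j) * y k)"
proof -
  define H where "H = (\<Sum>i<N. monom (h i) (N - 1 - i))"
  define B where "B k = (\<Prod>j\<in>{1..N} - {k}. [:- u j, 1:])" for k
  define p where "p k = (\<Prod>j\<in>{1..N} - {k}. u k - u j)" for k
  define S where "S k = (\<Sum>I | I \<subseteq> {1..N} - {k} \<and> card I = m. \<Prod>i\<in>I. u i)" for k
  define Q where "Q = (\<Sum>k=1..N. smult (y k / p k) (B k))"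
  have card: "card ({1..N} - {k}) = N - 1" if "k \<in> {1..N}" for k
    using that by simp
  have p0: "p k \<noteq> 0" if "k \<in> {1..N}" for k
    using that by (auto simp: p_def inj_on_eq_iff[OF inj])
  have polyB: "poly (B k) (u i) = (if i = k then p k else 0)" if "i \<in> {1..N}" for i k
    using that by (auto simp: B_def p_def poly_prod)
  have degB: "degree (B k) \<le> N - 1" if "k \<in> {1..N}" for k
    unfolding B_def by (rule order_trans[OF degree_prod_sum_le]) (use card[OF that] in auto)
  have "H = Q"
  proof (rule poly_eqI_degree)
    show "poly H x = poly Q x" if "x \<in> u ` {1..N}" for x
    proof -
      from that obtain k where k: "k \<in> {1..N}" "x = u k" by blast
      have "poly Q x = (\<Sum>i=1..N. if i = k then y i else 0)"
        unfolding Q_def poly_sum using k p0 by (intro sum.cong refl) (auto simp: polyB)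
      also have "\<dots> = poly H x"
        using k val[OF k(1)] by (simp add: H_def poly_sum poly_monom)
      finally show ?thesis by simp
    qed
    have "degree H \<le> N - 1"
      unfolding H_def by (intro degree_sum_le) (auto intro: order_trans[OF degree_monom_le])
    then show "degree H < card (u ` {1..N})"
      using m inj by (simp add: card_image)
    have "degree Q \<le> N - 1"
      unfolding Q_def by (intro degree_sum_le order_trans[OF degree_smult_le] degB) auto
    then show "degree Q < card (u ` {1..N})"
      using m inj by (simp add: card_image)
  qed
  moreover have "coeff H (N - 1 - m) = h m"
  proof -
    have "coeff H (N - 1 - m) = (\<Sum>i<N. if i = m then h i else 0)"
      unfolding H_def coeff_sum coeff_monom using m by (intro sum.cong refl) auto
    then show ?thesis using m by simp
  qed
  moreover have "coeff Q (N - 1 - m) = (\<Sum>k=1..N. y k / p k *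
      ((-1) ^ m * S k))"
    unfolding Q_def coeff_sum coeff_smult
  proof (intro sum.cong refl arg_cong[of _ _ "\<lambda>t. _ * t"])
    fix k assume k: "k \<in> {1..N}"
    show "coeff (B k) (N - 1 - m) = (-1) ^ m * S k"
      using coeff_prod_linear_factors[of "{1..N} - {k}" m u] m unfolding card[OF k] B_def S_def by simp
  qed
  ultimately show ?thesis
    unfolding S_def[symmetric] p_def[symmetric] by (simp add: sum_distrib_left mult_ac)
qed

section \<open>The inverse Joukowski map\<close>

text \<open>
  The inverse of $u \mapsto (u + 1/u)/2$ on the punctured unit disc, written as in the definition of
  \<^const>\<open>u_root\<close>.
\<close>

definition joukowski_inv :: "complex \<Rightarrow> complex" where
  "joukowski_inv a = (THE u. u ^ 2 - 2 * a * u + 1 = 0 \<and> norm u < 1)"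

text \<open>
  The two roots are mutually inverse, so uniqueness is clear, and existence can fail only if both lie on
  the unit circle. Then they are conjugate and \<^term>\<open>a\<close> is the real part of a number of modulus 1.
\<close>

lemma joukowski_inv_ex1:
  assumes "a \<notin> complex_of_real ` {-1..1}"
  shows "\<exists>!u. u ^ 2 - 2 * a * u + 1 = 0 \<and> norm u < 1"
proof (rule ex_ex1I)
  define u where "u = a + csqrt (a\<^sup>2 - 1)"
  define v where "v = a - csqrt (a\<^sup>2 - 1)"
  have uv: "u * v = 1"
    unfolding u_def v_def using power2_csqrt[of "a\<^sup>2 - 1"]
    by (simp add: algebra_simps power2_eq_square)
  have sum: "u + v = 2 * a" by (simp add: u_def v_def)
  have root: "u\<^sup>2 - 2 * a * u + 1 = 0" "v\<^sup>2 - 2 * a * v + 1 = 0"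
    using uv unfolding sum[symmetric] by (simp_all add: algebra_simps power2_eq_square)
  have nuv: "norm u * norm v = 1" using uv by (metis norm_mult norm_one)
  have "norm u \<noteq> 1"
  proof
    assume u1: "norm u = 1"
    then have "u * cnj u = 1" by (simp add: complex_norm_square[symmetric])
    then have "v = cnj u" using uv by (metis mult_cancel_left mult_zero_left zero_neq_one)
    then have "2 * a = of_real (2 * Re u)" using sum complex_add_cnj[of u] by simp
    then have "a = of_real (Re u)" by simp
    moreover have "Re u \<in> {-1..1}" using abs_Re_le_cmod[of u] u1 by auto
    ultimately show False using assms by (metis imageI)
  qed
  then have "norm u < 1 \<or> norm v < 1"
  proof (rule linorder_neqE_linordered_idom)
    assume "1 < norm u"
    moreover have "norm v = 1 / norm u"
      using nuv by (metis mult_zero_left nonzero_mult_div_cancel_left zero_neq_one)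
    ultimately show ?thesis by (simp add: divide_less_eq)
  qed simp
  then show "\<exists>u. u ^ 2 - 2 * a * u + 1 = 0 \<and> norm u < 1"
    using root by blast
next
  fix u v :: complex
  assume u: "u ^ 2 - 2 * a * u + 1 = 0 \<and> norm u < 1" and v: "v ^ 2 - 2 * a * v + 1 = 0 \<and> norm v < 1"
  have "(u - v) * (u * v - 1) = v * (u ^ 2 - 2 * a * u + 1) - u * (v ^ 2 - 2 * a * v + 1)"
    by (simp add: algebra_simps power2_eq_square)
  then have "(u - v) * (u * v - 1) = 0" using u v by simp
  moreover have "norm (u * v) < 1"
    using u v mult_strict_mono[of "norm u" 1 "norm v" 1] by (simp add: norm_mult)
  then have "u * v \<noteq> 1" by auto
  ultimately show "u = v" by simp
qed

lemma joukowski_inv: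
  assumes "a \<notin> complex_of_real ` {-1..1}"
  shows "joukowski_inv a ^ 2 - 2 * a * joukowski_inv a + 1 = 0" "norm (joukowski_inv a) < 1"
    "joukowski_inv a \<noteq> 0" "joukowski_inv a + 1 / joukowski_inv a = 2 * a"
proof -
  let ?u = "joukowski_inv a"
  show eq: "?u ^ 2 - 2 * a * ?u + 1 = 0" and "norm ?u < 1"
    using theI'[OF joukowski_inv_ex1[OF assms]] unfolding joukowski_inv_def by auto
  show "?u \<noteq> 0" using eq by auto
  then show "?u + 1 / ?u = 2 * a" using eq by (simp add: field_simps power2_eq_square)
qed

lemma holomorphic_on_joukowski_inv:
  "joukowski_inv holomorphic_on - complex_of_real ` {-1..1}"
proof -
  define f where "f u = (u + 1 / u) / 2" for u :: complex
  let ?S = "ball (0::complex) 1 - {0}"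
  have hol: "f holomorphic_on ?S"
    unfolding f_def by (intro holomorphic_intros) auto
  have "inj_on f ?S"
  proof (rule inj_onI)
    fix u v assume u: "u \<in> ?S" and v: "v \<in> ?S" and eq: "f u = f v"
    have "(u - v) * (u * v - 1) = 2 * u * v * (f u - f v)"
      using u v by (simp add: f_def field_simps)
    then have "(u - v) * (u * v - 1) = 0" using eq by simp
    moreover have "norm (u * v) < 1"
      using u v mult_strict_mono[of "norm u" 1 "norm v" 1] by (simp add: norm_mult)
    then have "u * v \<noteq> 1" by auto
    ultimately show "u = v" by simp
  qed
  then obtain g where g: "g holomorphic_on f ` ?S" "\<And>u. u \<in> ?S \<Longrightarrow> g (f u) = u"
    using holomorphic_has_inverse[OF hol] by (metis open_ball open_delete)
  have pre: "joukowski_inv a \<in> ?S" "f (joukowski_inv a) = a" if "a \<notin> complex_of_real ` {-1..1}" for a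
    using joukowski_inv[OF that] by (auto simp: f_def)
  have "g holomorphic_on - complex_of_real ` {-1..1}"
    using g(1) by (rule holomorphic_on_subset) (use pre in force)
  then show ?thesis
    by (rule holomorphic_transform) (use g(2) pre in force)
qed

section \<open>The roots and the generating function on the strip\<close>

text \<open>
  The continuation of \<^const>\<open>w_fun\<close> to the strip $0 < \mathrm{Re}\, z < 1$, on which $1-z$ and $cz$ both
  stay in the right half-plane, so that principal logarithms are holomorphic.
\<close>

definition w_cont :: "nat \<Rightarrow> real \<Rightarrow> complex \<Rightarrow> complex" where
  "w_cont N c z = 1 / 2 * exp ((Ln (1 - z) - Ln (of_real c * z)) / of_nat N)"

definition root_cont :: "nat \<Rightarrow> real \<Rightarrow> nat \<Rightarrow> complex \<Rightarrow> complex" where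
  "root_cont N c j z = joukowski_inv (1 + theta N j * w_cont N c z)"

text \<open>
  The right-hand side of the theorem, continued to the strip, for $e = b + N - 1$ and $m = l - b$.
\<close>

definition overshoot_gf :: "nat \<Rightarrow> real \<Rightarrow> nat \<Rightarrow> nat \<Rightarrow> complex \<Rightarrow> complex" where
  "overshoot_gf N c e m z = (-1) ^ m * (\<Sum>k=1..N.
     (\<Sum>I | I \<subseteq> {1..N} - {k} \<and> card I = m. \<Prod>i\<in>I. root_cont N c i z) /
     (\<Prod>j\<in>{1..N} - {k}. root_cont N c k z - root_cont N c j z) * root_cont N c k z ^ e)"

text \<open>
  Raising to the power \<^term>\<open>N\<close> removes the branch: this and \<open>w_cont_power\<close> are all that is used of
  \<open>\<theta>\<^sub>j\<close> and \<open>w\<close> when the roots are substituted into the symbol.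
\<close>

lemma theta_power:
  assumes "1 \<le> N"
  shows "theta N j ^ N = - ((-1) ^ N)"
proof -
  have "exp (\<i> * of_real ((2 * real j - 1) / real N * pi)) ^ N =
      exp (of_nat N * (\<i> * of_real ((2 * real j - 1) / real N * pi)))"
    by (rule exp_of_nat_mult[symmetric])
  also have "of_nat N * (\<i> * of_real ((2 * real j - 1) / real N * pi)) =
      2 * of_nat j * of_real pi * \<i> - of_real pi * \<i>"
    using assms by (simp add: field_simps)
  also have "exp \<dots> = -1"
  proof -
    have "exp (2 * of_nat j * of_real pi * \<i>) = 1"
      by (rule exp_eq_1[THEN iffD2]) (auto intro!: exI[of _ "int j"])
    then show ?thesis by (simp add: exp_diff)
  qed
  finally show ?thesis
    unfolding theta_def by (subst power_minus) simp
qed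

lemma inj_on_theta: "inj_on (theta N) {1..N}"
proof (rule inj_onI)
  fix j k assume j: "j \<in> {1..N}" and k: "k \<in> {1..N}" and eq: "theta N j = theta N k"
  then have N: "real N > 0" by auto
  from eq obtain n :: int where "\<i> * of_real ((2 * real j - 1) / real N * pi) =
      \<i> * of_real ((2 * real k - 1) / real N * pi) + (of_int (2 * n) * pi) * \<i>"
    unfolding theta_def neg_equal_iff_equal exp_eq by blast
  then have "(2 * real j - 1) / real N * pi = (2 * real k - 1) / real N * pi + of_int (2 * n) * pi"
    by (auto dest: arg_cong[of _ _ Im])
  also have "\<dots> = ((2 * real k - 1) / real N + of_int (2 * n)) * pi"
    by (simp add: algebra_simps)
  finally have "(2 * real j - 1) / real N = (2 * real k - 1) / real N + of_int (2 * n)"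
    by (simp only: mult_right_cancel[OF pi_neq_zero])
  then have "real_of_int (int j) = real_of_int (int k + n * int N)"
    using N by (simp add: field_simps)
  then have jk: "int j = int k + n * int N" by (simp only: of_int_eq_iff)
  have "n = 0"
  proof (rule ccontr)
    assume "n \<noteq> 0"
    then have "1 * int N \<le> \<bar>n\<bar> * int N" by (intro mult_right_mono) auto
    then have "int N \<le> \<bar>int j - int k\<bar>" using jk by (simp add: abs_mult)
    then show False using j k by auto
  qed
  then show "j = k" using jk by simp
qed

lemma w_cont_of_real:
  assumes "1 \<le> N" "0 < c" "0 < z" "z < 1"
  shows "w_cont N c (of_real z) = of_real (w_fun N c z)"
proof -
  have Ln: "Ln (1 - of_real z) = of_real (ln (1 - z))" "Ln (of_real c * of_real z) = of_real (ln (c * z))"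
    using assms Ln_of_real[of "1 - z"] Ln_of_real[of "c * z"] by simp_all
  define r where "r = (ln (1 - z) - ln (c * z)) / real N"
  have w: "w_fun N c z = 1 / 2 * exp r"
    unfolding w_fun_def r_def using assms
    by (simp add: root_powr_inverse powr_def exp_diff diff_divide_distrib)
  have eq: "(of_real (ln (1 - z)) - of_real (ln (c * z))) / of_nat N =
      complex_of_real r"
    by (simp add: r_def)
  show ?thesis
    unfolding w_cont_def Ln eq w exp_of_real by simp
qed

lemma w_cont_power:
  assumes "1 \<le> N" "0 < c" "z \<noteq> 0" "z \<noteq> 1"
  shows "(2 * w_cont N c z) ^ N = (1 - z) / (of_real c * z)"
proof -
  have "(2 * w_cont N c z) ^ N = exp (of_nat N * ((Ln (1 - z) - Ln (of_real c * z)) / of_nat N))"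
    unfolding w_cont_def exp_of_nat_mult by simp
  also have "\<dots> = exp (Ln (1 - z) - Ln (of_real c * z))"
    using assms by simp
  also have "\<dots> = (1 - z) / (of_real c * z)"
    using assms by (simp add: exp_diff)
  finally show ?thesis .
qed

lemma u_root_eq_root_cont:
  assumes "1 \<le> N" "0 < c" "0 < z" "z < 1"
  shows "u_root N c z j = root_cont N c j (of_real z)"
  unfolding root_cont_def u_root_def joukowski_inv_def w_cont_of_real[OF assms] ..

text \<open>
  On the cut the root would have modulus 1, so $1/z$ would be of the form $1 - c s$ with $s \ge 0$, hence
  real and at most 1; but then $z$ would be real and in $(0,1)$, where $1/z > 1$.
\<close>

lemma joukowski_argument_avoids_cut:
  assumes "1 \<le> N" "0 < c" "0 < Re z" "Re z < 1"
  shows "1 + theta N j * w_cont N c z \<notin> complex_of_real ` {-1..1}"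
proof
  assume "1 + theta N j * w_cont N c z \<in> complex_of_real ` {-1..1}"
  then obtain t where t: "t \<in> {-1..1}" "1 + theta N j * w_cont N c z = of_real t" by blast
  have z: "z \<noteq> 0" "z \<noteq> 1" using assms by auto
  define s where "s = (2 - 2 * t) ^ N"
  have s: "0 \<le> s" using t by (simp add: s_def)
  have "theta N j * (2 * w_cont N c z) = - of_real (2 - 2 * t)"
  proof -
    have "theta N j * (2 * w_cont N c z) = 2 * ((1 + theta N j * w_cont N c z) - 1)"
      by (simp add: algebra_simps)
    then show ?thesis unfolding t(2) by simp
  qed
  \<comment> \<open>The powers of \<open>\<theta>\<^sub>j\<close> and \<open>2w\<close> are known, which gives \<open>(1 - z) / (c * z) = - s\<close>, that is \<open>1 / z = 1 - c * s\<close>.\<close>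
  then have "theta N j ^ N * (2 * w_cont N c z) ^ N = (-1) ^ N * of_real s"
    unfolding power_mult_distrib[symmetric] by (simp only:, subst power_minus) (simp add: s_def)
  then have "(1 - z) / (of_real c * z) = - of_real s"
    unfolding theta_power[OF assms(1)] w_cont_power[OF assms(1,2) z]
    by (cases "even N") (simp_all only: uminus_power_if if_True if_False power_one mult_1_left
        mult_minus_left minus_minus, metis minus_minus)
  then have "1 - z = - (of_real s * of_real c * z)"
    using assms z by (simp add: field_simps)
  then have "z * of_real (1 - s * c) = 1"
    by (simp add: algebra_simps)
  then have "Re (z * of_real (1 - s * c)) = Re 1"
    by (rule arg_cong)
  then have "Re z * (1 - s * c) = 1" by simp
  moreover have "Re z * (1 - s * c) \<le> Re z * 1"
    using s assms by (intro mult_left_mono) auto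
  ultimately show False using assms by linarith
qed

lemma root_cont:
  assumes "1 \<le> N" "0 < c" "0 < Re z" "Re z < 1"
  shows "norm (root_cont N c j z) < 1" "root_cont N c j z \<noteq> 0"
    "z * symbol N c (1 / root_cont N c j z) = 1"
proof -
  let ?u = "root_cont N c j z"
  note J = joukowski_inv[OF joukowski_argument_avoids_cut[OF assms, of j], folded root_cont_def]
  show "norm ?u < 1" and u0: "?u \<noteq> 0" using J by auto
  have z: "z \<noteq> 0" "z \<noteq> 1" using assms by auto
  have "2 - 1 / ?u - ?u = - (theta N j * (2 * w_cont N c z))"
    using J(4) by (simp add: algebra_simps)
  then have "symbol N c (1 / ?u) = 1 - of_real c * (- (theta N j * (2 * w_cont N c z))) ^ N"
    using u0 by (simp add: symbol_eq)
  also have "(- (theta N j * (2 * w_cont N c z))) ^ N =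
      (-1) ^ N * (theta N j ^ N * (2 * w_cont N c z) ^ N)"
    by (subst power_minus) (simp add: power_mult_distrib)
  also have "\<dots> = - ((1 - z) / (of_real c * z))"
    unfolding theta_power[OF assms(1)] w_cont_power[OF assms(1,2) z] by simp
  finally show "z * symbol N c (1 / ?u) = 1"
    using z assms by (simp add: field_simps)
qed

lemma inj_on_root_cont:
  assumes "1 \<le> N" "0 < c" "0 < Re z" "Re z < 1"
  shows "inj_on (\<lambda>j. root_cont N c j z) {1..N}"
proof (rule inj_onI)
  fix j k assume j: "j \<in> {1..N}" and k: "k \<in> {1..N}" and eq: "root_cont N c j z = root_cont N c k z"
  note J = joukowski_inv(4)[OF joukowski_argument_avoids_cut[OF assms], folded root_cont_def]
  have "theta N j * w_cont N c z = theta N k * w_cont N c z"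
    using J[of j] J[of k] eq by auto
  moreover have "w_cont N c z \<noteq> 0" by (simp add: w_cont_def)
  ultimately show "j = k" using inj_on_theta[of N] j k by (auto dest: inj_onD)
qed

text \<open>
  Optional stopping at $v = 1/u_k$ and multiplication by $u_k^{b+N-1}$ turn the negative powers into the
  interpolation conditions of \<open>interpolation_coefficient\<close>. This is carried out for complex \<^term>\<open>z\<close>, so
  that the agreement of the two functions near 0 is already an identity on an open set.
\<close>

lemma overshoot_series_eq_gf:
  assumes "1 \<le> N" "1 \<le> b" "0 < c" "0 < Re z" "Re z < 1" and z: "norm z * symbol_bound N c < 1"
    and m: "m < N"
  shows "(\<Sum>n. of_real (overshoot_prob N c b (Suc n) (b + int m)) * z ^ Suc n) =
     overshoot_gf N c (nat (b + int N - 1)) m z"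
  unfolding overshoot_gf_def
proof (rule interpolation_coefficient[where h = "\<lambda>i. \<Sum>n. of_real (overshoot_prob N c b (Suc n) (b + int i)) * z ^ Suc n"])
  fix k assume "k \<in> {1..N}"
  let ?u = "root_cont N c k z"
  let ?h = "\<lambda>i. \<Sum>n. of_real (overshoot_prob N c b (Suc n) (b + int i)) * z ^ Suc n"
  let ?e = "nat (b + int N - 1)"
  note u = root_cont[OF assms(1,3-5), of k]
  have v: "norm (1 / ?u) > 1" using u by (simp add: norm_divide)
  have "1 = (\<Sum>l\<in>{b..b + int N - 1}. (\<Sum>n. of_real (overshoot_prob N c b (Suc n) l) * z ^ Suc n) * (1 / ?u) powi l)"
    using overshoot_optional_stopping[OF _ assms(2) z v u(3)] assms by simp
  also have "\<dots> = (\<Sum>i<N. ?h i * (1 / ?u) powi (b + int i))"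
    by (rule sum.reindex_bij_witness[of _ "\<lambda>i. b + int i" "\<lambda>l. nat (l - b)"]) auto
  finally have "?u ^ ?e = (\<Sum>i<N. ?h i * (1 / ?u) powi (b + int i)) * ?u ^ ?e"
    by simp
  also have "\<dots> = (\<Sum>i<N. ?h i * ?u ^ (N - 1 - i))"
    unfolding sum_distrib_right
  proof (intro sum.cong refl)
    fix i assume i: "i \<in> {..<N}"
    \<comment> \<open>\<open>b + N - 1 = (b + i) + (N - 1 - i)\<close>, where \<open>l = b + i\<close>.\<close>
    then have e: "?e = nat (b + int i) + (N - 1 - i)" using assms(2) by auto
    have "(1 / ?u) powi (b + int i) = (1 / ?u) ^ nat (b + int i)"
      using assms(2) by (simp add: power_int_def)
    then show "?h i * (1 / ?u) powi (b + int i) * ?u ^ ?e = ?h i * ?u ^ (N - 1 - i)"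
      unfolding e power_add using u(2) by (simp add: power_one_over)
  qed
  finally show "(\<Sum>i<N. ?h i * ?u ^ (N - 1 - i)) = ?u ^ ?e" ..
qed (use inj_on_root_cont assms in auto)

lemma holomorphic_on_root_cont:
  assumes "1 \<le> N" "0 < c"
  shows "root_cont N c j holomorphic_on {z. 0 < Re z \<and> Re z < 1}"
proof -
  let ?S = "{z. 0 < Re z \<and> Re z < 1}"
  have "w_cont N c holomorphic_on ?S"
    unfolding w_cont_def
    by (intro holomorphic_intros) (use assms in \<open>auto simp: complex_nonpos_Reals_iff zero_less_mult_iff mult_le_0_iff\<close>)
  then have "(\<lambda>z. 1 + theta N j * w_cont N c z) holomorphic_on ?S"
    by (intro holomorphic_intros)
  moreover have "(\<lambda>z. 1 + theta N j * w_cont N c z) ` ?S \<subseteq> - complex_of_real ` {-1..1}"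
    using joukowski_argument_avoids_cut[OF assms] by auto
  ultimately have "(joukowski_inv \<circ> (\<lambda>z. 1 + theta N j * w_cont N c z)) holomorphic_on ?S"
    by (rule holomorphic_on_compose_gen[OF _ holomorphic_on_joukowski_inv])
  then show ?thesis by (simp add: o_def root_cont_def[abs_def])
qed

lemma holomorphic_on_overshoot_gf:
  assumes "1 \<le> N" "0 < c"
  shows "overshoot_gf N c e m holomorphic_on {z. 0 < Re z \<and> Re z < 1}"
  unfolding overshoot_gf_def
  by (intro holomorphic_intros holomorphic_on_root_cont assms)
     (auto dest!: inj_onD[OF inj_on_root_cont[OF assms]])

section \<open>Analytic continuation of power series\<close>

text \<open>
  Two continuations live on different domains whose intersection may be disconnected; the identity
  theorem applies on the component of the intersection that contains the segment.
\<close>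

lemma continued_value_unique:
  assumes "continued_value a z v" "continued_value a z w"
  shows "v = w"
proof -
  let ?seg = "closed_segment 0 (complex_of_real z)"
  obtain S f r where S: "open S" "?seg \<subseteq> S" "f holomorphic_on S" "r > 0"
    and f: "\<And>x. x \<in> ball 0 r \<Longrightarrow> (\<lambda>k. complex_of_real (a (Suc k)) * x ^ Suc k) sums f x"
    and v: "f (of_real z) = v"
    using assms(1) unfolding continued_value_def by blast
  obtain T g s where T: "open T" "?seg \<subseteq> T" "g holomorphic_on T" "s > 0"
    and g: "\<And>x. x \<in> ball 0 s \<Longrightarrow> (\<lambda>k. complex_of_real (a (Suc k)) * x ^ Suc k) sums g x"
    and w: "g (of_real z) = w"
    using assms(2) unfolding continued_value_def by blast
  define C where "C = connected_component_set (S \<inter> T) 0"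
  have 0: "0 \<in> C" using S T by (auto simp: C_def)
  have segC: "?seg \<subseteq> C"
    unfolding C_def using S T by (intro connected_component_maximal) auto
  have CS: "C \<subseteq> S \<inter> T" unfolding C_def by (rule connected_component_subset)
  have oC: "open C" unfolding C_def using S T by (intro open_connected_component) auto
  have "f (of_real z) = g (of_real z)"
  proof (rule analytic_continuation_open[where f = f and g = g])
    show "open (C \<inter> ball 0 (min r s))" using oC by auto
    show "C \<inter> ball 0 (min r s) \<noteq> {}" using 0 S T by force
    show "f holomorphic_on C" "g holomorphic_on C"
      using S T CS by (blast intro: holomorphic_on_subset)+
    show "f x = g x" if "x \<in> C \<inter> ball 0 (min r s)" for x
      using f[of x] g[of x] that by (auto intro: sums_unique2)
    show "connected C" by (simp add: C_def)
  qed (use oC segC in auto)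
  then show ?thesis using v w by simp
qed

lemma holomorphic_on_powser_Suc:
  fixes a :: "nat \<Rightarrow> complex"
  assumes "\<And>y. y \<in> ball 0 r \<Longrightarrow> (\<lambda>k. a (Suc k) * y ^ Suc k) sums f y"
  shows "f holomorphic_on ball 0 r"
proof (rule power_series_holomorphic)
  fix y :: complex assume "y \<in> ball 0 r"
  then show "(\<lambda>n. (if n = 0 then 0 else a n) * (y - 0) ^ n) sums f y"
    using assms[of y] sums_Suc_iff[of "\<lambda>n. (if n = 0 then 0 else a n) * (y - 0) ^ n" "f y"] by simp
qed

lemma powser_term_summable:
  fixes a :: "nat \<Rightarrow> real" and x :: "'a :: {real_normed_field, banach}"
  assumes "summable (\<lambda>k. a (Suc k) * z ^ Suc k)" "norm x < z"
  shows "summable (\<lambda>k. of_real (a (Suc k)) * x ^ Suc k)"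
proof -
  have z: "z > 0" using assms(2) norm_ge_zero[of x] by linarith
  have "summable (\<lambda>k. a (Suc k) * z ^ k)"
    using summable_mult2[OF assms(1), of "1 / z"] z by simp
  then have "summable (\<lambda>k. of_real (a (Suc k)) * of_real z ^ k :: 'a)"
    using summable_of_real[of "\<lambda>k. a (Suc k) * z ^ k"] by simp
  then have "summable (\<lambda>k. of_real (a (Suc k)) * x ^ k)"
    by (rule powser_inside) (use assms(2) z in simp)
  then show ?thesis
    using summable_mult2[of "\<lambda>k. of_real (a (Suc k)) * x ^ k" x] by (simp add: mult_ac)
qed

lemma continued_value_inside:
  assumes "summable (\<lambda>k. a (Suc k) * z ^ Suc k)" "0 < x" "x < z"
  shows "continued_value a x (of_real (\<Sum>k. a (Suc k) * x ^ Suc k))"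
proof -
  define f where "f y = (\<Sum>k. complex_of_real (a (Suc k)) * y ^ Suc k)" for y
  have f: "(\<lambda>k. complex_of_real (a (Suc k)) * y ^ Suc k) sums f y" if "y \<in> ball 0 z" for y
    unfolding f_def using powser_term_summable[OF assms(1)] that by (intro summable_sums) simp
  have hol: "f holomorphic_on ball 0 z"
    by (rule holomorphic_on_powser_Suc[OF f])
  have seg: "closed_segment 0 (complex_of_real x) \<subseteq> ball 0 z"
    using assms by (intro closed_segment_subset) auto
  have "(\<lambda>k. complex_of_real (a (Suc k) * x ^ Suc k)) sums f (of_real x)"
    using f[of "of_real x"] assms by simp
  moreover have "summable (\<lambda>k. a (Suc k) * x ^ Suc k)"
    using powser_term_summable[OF assms(1), of x] assms by simp
  then have "(\<lambda>k. complex_of_real (a (Suc k) * x ^ Suc k)) sums of_real (\<Sum>k. a (Suc k) * x ^ Suc k)"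
    by (intro sums_of_real summable_sums)
  ultimately have "f (of_real x) = of_real (\<Sum>k. a (Suc k) * x ^ Suc k)"
    by (rule sums_unique2)
  then show ?thesis
    unfolding continued_value_def using hol seg f assms
    by (intro exI[of _ "ball 0 z"] exI[of _ f] exI[of _ z]) auto
qed

text \<open>
  Abel's limit theorem, from the summation by parts
  $\sum a_n t^n - s = (1-t) \sum d_n t^n$ with $d_n = a_0 + \dots + a_n - s \to 0$.
\<close>

lemma abel_limit:
  fixes a :: "nat \<Rightarrow> real"
  assumes "a sums s"
  shows "((\<lambda>t. \<Sum>n. a n * t ^ n) \<longlongrightarrow> s) (at_left 1)"
proof -
  define d where "d n = (\<Sum>k\<le>n. a k) - s" for n
  have d0: "d \<longlonglongrightarrow> 0"
    using assms unfolding sums_def_le d_def by (simp add: LIM_zero)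
  then have "Bseq d" by (intro convergent_imp_Bseq) (auto simp: convergent_def)
  then obtain K where K: "K > 0" "\<And>n. \<bar>d n\<bar> \<le> K" by (auto simp: Bseq_def)
  have summ: "summable (\<lambda>n. a n * t ^ n)" if "0 \<le> t" "t < 1" for t
    using powser_inside[of a 1 t] assms that by (simp add: sums_iff)
  have sumd: "summable (\<lambda>n. \<bar>d n\<bar> * t ^ n)" if "0 \<le> t" "t < 1" for t
    by (rule summable_comparison_test'[of "\<lambda>n. K * t ^ n"])
       (use that K in \<open>auto simp: abs_mult intro!: mult_right_mono summable_mult summable_geometric\<close>)
  have rep: "(\<Sum>n. a n * t ^ n) - s = (1 - t) * (\<Sum>n. d n * t ^ n)" if t: "0 \<le> t" "t < 1" for t
  proof -
    have sd: "summable (\<lambda>n. d n * t ^ n)"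
      by (rule summable_rabs_cancel) (use sumd[OF t] t in \<open>simp add: abs_mult\<close>)
    have "(\<lambda>n. d (Suc n) * t ^ Suc n) sums ((\<Sum>n. d n * t ^ n) - d 0)"
      using summable_sums[OF sd] by (subst sums_Suc_iff) simp
    moreover have "(\<lambda>n. t * (d n * t ^ n)) sums (t * (\<Sum>n. d n * t ^ n))"
      by (intro sums_mult summable_sums sd)
    ultimately have "(\<lambda>n. d (Suc n) * t ^ Suc n - t * (d n * t ^ n)) sums
        ((\<Sum>n. d n * t ^ n) - d 0 - t * (\<Sum>n. d n * t ^ n))"
      by (rule sums_diff)
    moreover have "d (Suc n) * t ^ Suc n - t * (d n * t ^ n) = a (Suc n) * t ^ Suc n" for n
      by (simp add: d_def algebra_simps)
    ultimately have "(\<lambda>n. a (Suc n) * t ^ Suc n) sums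
        ((\<Sum>n. d n * t ^ n) - d 0 - t * (\<Sum>n. d n * t ^ n))" by simp
    then have "(\<lambda>n. a n * t ^ n) sums ((\<Sum>n. d n * t ^ n) - d 0 - t * (\<Sum>n. d n * t ^ n) + a 0)"
      using sums_Suc_iff[of "\<lambda>n. a n * t ^ n"] by (simp add: algebra_simps)
    then show ?thesis by (simp add: sums_iff d_def algebra_simps)
  qed
  have "\<forall>\<^sub>F t in at_left 1. \<bar>(\<Sum>n. a n * t ^ n) - s\<bar> < e" if e: "e > 0" for e
  proof -
    \<comment> \<open>The first \<open>M\<close> terms are killed by the factor \<open>1 - t\<close>; the others are below \<open>e / 2\<close>, and \<open>\<Sum>t ^ n = 1 / (1 - t)\<close>.\<close>
    obtain M where M: "\<And>n. n \<ge> M \<Longrightarrow> \<bar>d n\<bar> < e / 2"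
      using LIMSEQ_D[OF d0, of "e / 2"] e by auto
    have "\<forall>\<^sub>F t in at_left (1::real). (1 - t) * (\<Sum>n<M. \<bar>d n\<bar>) < e / 2"
    proof -
      have "((\<lambda>t. (1 - t) * (\<Sum>n<M. \<bar>d n\<bar>)) \<longlongrightarrow> (1 - 1) * (\<Sum>n<M. \<bar>d n\<bar>)) (at_left (1::real))"
        by (intro tendsto_intros)
      then show ?thesis using e by (intro order_tendstoD(2)) auto
    qed
    moreover have "\<forall>\<^sub>F t in at_left (1::real). 0 \<le> t \<and> t < 1"
      using eventually_at_left_real[of 0 1] by (rule eventually_mono) auto
    ultimately show ?thesis
    proof eventually_elim
      fix t :: real assume t1: "(1 - t) * (\<Sum>n<M. \<bar>d n\<bar>) < e / 2" and t: "0 \<le> t \<and> t < 1"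
      have sd: "summable (\<lambda>n. \<bar>d n\<bar> * t ^ n)" using sumd t by blast
      have "\<bar>\<Sum>n. d n * t ^ n\<bar> \<le> (\<Sum>n. \<bar>d n * t ^ n\<bar>)"
        by (rule summable_rabs) (use sd t in \<open>simp add: abs_mult\<close>)
      also have "\<dots> = (\<Sum>n. \<bar>d n\<bar> * t ^ n)" using t by (simp add: abs_mult)
      also have "\<dots> = (\<Sum>n. \<bar>d (n + M)\<bar> * t ^ (n + M)) + (\<Sum>n<M. \<bar>d n\<bar> * t ^ n)"
        by (rule suminf_split_initial_segment[OF sd])
      also have "(\<Sum>n<M. \<bar>d n\<bar> * t ^ n) \<le> (\<Sum>n<M. \<bar>d n\<bar>)"
        using t by (intro sum_mono mult_left_le) (auto intro: power_le_one)
      also have "(\<Sum>n. \<bar>d (n + M)\<bar> * t ^ (n + M)) \<le> (\<Sum>n. e / 2 * t ^ n)"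
      proof (rule suminf_le)
        fix n
        show "\<bar>d (n + M)\<bar> * t ^ (n + M) \<le> e / 2 * t ^ n"
          using M[of "n + M"] t by (intro mult_mono) (auto intro: power_decreasing less_imp_le)
        show "summable (\<lambda>n. \<bar>d (n + M)\<bar> * t ^ (n + M))"
          using sd by (rule summable_ignore_initial_segment)
        show "summable (\<lambda>n. e / 2 * t ^ n)" using t by (intro summable_mult summable_geometric) auto
      qed
      also have "(\<Sum>n. e / 2 * t ^ n) = e / 2 / (1 - t)"
        using t by (subst suminf_mult) (auto simp: suminf_geometric intro: summable_geometric)
      finally have "(1 - t) * \<bar>\<Sum>n. d n * t ^ n\<bar> \<le> (1 - t) * (e / 2 / (1 - t) + (\<Sum>n<M. \<bar>d n\<bar>))"
        using t by (intro mult_left_mono) auto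
      also have "\<dots> = e / 2 + (1 - t) * (\<Sum>n<M. \<bar>d n\<bar>)"
        using t by (simp add: field_simps)
      finally show "\<bar>(\<Sum>n. a n * t ^ n) - s\<bar> < e"
        using t1 t rep[of t] by (simp add: abs_mult)
    qed
  qed
  then show ?thesis by (intro tendstoI) (simp add: dist_real_def)
qed

text \<open>
  If the series diverges at \<^term>\<open>z\<close>, the claim is uniqueness of the continued value. If it converges, then
  on $(0,z)$ its sum is itself a continued value and so agrees with \<^term>\<open>F\<close>; at the end point, which may
  lie on the circle of convergence, Abel's theorem and continuity of \<^term>\<open>F\<close> give the claim.
\<close>

lemma gen_fun_eq_continuation:
  assumes z: "0 < z" and cont: "\<And>x. 0 < x \<Longrightarrow> x \<le> z \<Longrightarrow> continued_value a x (F x)"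
    and F: "(F \<longlongrightarrow> F z) (at_left z)"
  shows "gen_fun a z = F z"
proof (cases "summable (\<lambda>k. a (Suc k) * z ^ Suc k)")
  case False
  have "(THE v. continued_value a z v) = F z"
    using cont[of z] z by (intro the_equality) (auto intro: continued_value_unique)
  then show ?thesis using False by (simp add: gen_fun_def)
next
  case True
  define A where "A n = (if n = 0 then 0 else a n * z ^ n)" for n
  define s where "s = (\<Sum>k. a (Suc k) * z ^ Suc k)"
  have "A sums s"
    using summable_sums[OF True] sums_Suc_iff[of A s] by (simp add: A_def s_def)
  then have "((\<lambda>t. \<Sum>n. A n * t ^ n) \<longlongrightarrow> s) (at_left 1)"
    by (rule abel_limit)
  moreover have "filterlim (\<lambda>x. x / z) (at_left 1) (at_left z)"
  proof -
    have "((\<lambda>x. x / z) \<longlongrightarrow> z / z) (at_left z)" using z by (intro tendsto_intros) auto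
    moreover have "\<forall>\<^sub>F x in at_left z. x / z \<in> {..<1} \<and> x / z \<noteq> 1"
      using z by (auto simp: eventually_at_filter)
    ultimately show ?thesis using z unfolding filterlim_at by auto
  qed
  ultimately have lim: "((\<lambda>x. \<Sum>n. A n * (x / z) ^ n) \<longlongrightarrow> s) (at_left z)"
    by (rule filterlim_compose)
  have "\<forall>\<^sub>F x in at_left z. complex_of_real (\<Sum>n. A n * (x / z) ^ n) = F x"
    using eventually_at_left_real[OF z]
  proof (rule eventually_mono)
    fix x assume x: "x \<in> {0<..<z}"
    have "summable (\<lambda>k. a (Suc k) * x ^ Suc k)"
      using powser_term_summable[OF True, of x] x by simp
    then have "(\<lambda>n. A (Suc n) * (x / z) ^ Suc n) sums (\<Sum>k. a (Suc k) * x ^ Suc k)"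
      using z by (simp add: A_def power_divide summable_sums)
    then have "(\<Sum>n. A n * (x / z) ^ n) = (\<Sum>k. a (Suc k) * x ^ Suc k)"
      by (subst (asm) sums_Suc_iff) (simp add: A_def sums_iff)
    then show "complex_of_real (\<Sum>n. A n * (x / z) ^ n) = F x"
      using continued_value_unique[OF continued_value_inside[OF True, of x] cont[of x]] x by simp
  qed
  then have "(F \<longlongrightarrow> of_real s) (at_left z)"
    using tendsto_of_real[OF lim] by (rule Lim_transform_eventually[rotated])
  then have "of_real s = F z"
    using F by (rule tendsto_unique[rotated]) simp
  then show ?thesis using True by (simp add: gen_fun_def s_def)
qed

text \<open>
  A power series on a disc around 0 and a holomorphic function on the strip that agree on the overlap form
  one holomorphic function on the union, which is connected and contains the segment.
\<close>

lemma continued_value_glue: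
  assumes \<rho>: "\<rho> > 0"
    and sums: "\<And>z. z \<in> ball 0 \<rho> \<Longrightarrow> (\<lambda>k. complex_of_real (a (Suc k)) * z ^ Suc k) sums H z"
    and F: "F holomorphic_on {z. 0 < Re z \<and> Re z < 1}"
    and eq: "\<And>z. z \<in> ball 0 \<rho> \<Longrightarrow> 0 < Re z \<Longrightarrow> Re z < 1 \<Longrightarrow> H z = F z"
    and x: "0 < x" "x < 1"
  shows "continued_value a x (F (of_real x))"
proof -
  let ?T = "{z. 0 < Re z \<and> Re z < 1}"
  let ?B = "ball 0 \<rho> :: complex set"
  define f where "f z = (if z \<in> ?B then H z else F z)" for z
  have T: "?T = {z. 0 < Re z} \<inter> {z. Re z < 1}" by auto
  have oT: "open ?T"
    unfolding T by (intro open_Int open_halfspace_Re_lt open_halfspace_Re_gt)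
  have cT: "connected ?T"
    unfolding T by (intro convex_connected convex_Int convex_halfspace_Re_lt convex_halfspace_Re_gt)
  have "H holomorphic_on ?B"
    by (rule holomorphic_on_powser_Suc[OF sums])
  then have hol: "f holomorphic_on ?B \<union> ?T"
    unfolding f_def by (intro holomorphic_on_If_Un F oT open_ball) (use eq in auto)
  have "complex_of_real (min \<rho> 1 / 2) \<in> ?B \<inter> ?T" using \<rho> by (auto simp: norm_of_real)
  then have conn: "connected (?B \<union> ?T)"
    by (intro connected_Un cT connected_ball) blast
  have seg: "closed_segment 0 (complex_of_real x) \<subseteq> ?B \<union> ?T"
  proof
    fix y assume "y \<in> closed_segment 0 (complex_of_real x)"
    then obtain t where t: "0 \<le> t" "t \<le> 1" and y: "y = of_real (t * x)"
      by (auto simp: in_segment scaleR_conv_of_real)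
    show "y \<in> ?B \<union> ?T"
    proof (cases "t = 0")
      case False
      then have "0 < t * x" using t x by simp
      moreover have "t * x < 1" using t x mult_right_mono[of t 1 x] by linarith
      ultimately show ?thesis by (simp add: y)
    qed (use \<rho> y in auto)
  qed
  have "f (of_real x) = F (of_real x)"
    using eq[of "of_real x"] x by (simp add: f_def)
  then show ?thesis
    unfolding continued_value_def using oT conn seg hol \<rho> sums
    by (intro exI[of _ "?B \<union> ?T"] exI[of _ f] exI[of _ \<rho>]) (auto simp: f_def)
qed

text \<open>
  Zeros of a non-zero power series are isolated, so values on the positive side of 0 alone determine the
  coefficients.
\<close>

lemma powser_coeffs_unique_pos:
  fixes a b :: "nat \<Rightarrow> real"
  assumes r: "0 < r"
    and a: "\<And>x. 0 < x \<Longrightarrow> x < r \<Longrightarrow> (\<lambda>k. a (Suc k) * x ^ Suc k) sums f x"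
    and b: "\<And>x. 0 < x \<Longrightarrow> x < r \<Longrightarrow> (\<lambda>k. b (Suc k) * x ^ Suc k) sums f x"
    and k: "1 \<le> k"
  shows "a k = b k"
proof (rule ccontr)
  assume ne: "a k \<noteq> b k"
  define d where "d n = (if n = 0 then 0 else a n - b n)" for n
  define g where "g x = (\<Sum>n. d n * x ^ n)" for x
  have d: "(\<lambda>n. d n * x ^ n) sums 0" if x: "0 < x" "x < r" for x
  proof -
    have "(\<lambda>k. d (Suc k) * x ^ Suc k) sums 0"
      using sums_diff[OF a[OF x] b[OF x]] by (simp add: d_def algebra_simps)
    then show ?thesis using sums_Suc_iff[of "\<lambda>n. d n * x ^ n" 0] by (simp add: d_def)
  qed
  have g: "(\<lambda>n. d n * x ^ n) sums g x" if "norm x < r / 2" for x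
    unfolding g_def
    by (intro summable_sums powser_inside[OF sums_summable[OF d[of "r / 2"]]]) (use that r in auto)
  have g0: "g 0 = 0" by (simp add: g_def d_def)
  have dk: "d k \<noteq> 0" "0 < k" using ne k by (auto simp: d_def)
  obtain s where s: "0 < s" "\<And>z. z \<in> cball 0 s - {0} \<Longrightarrow> g z \<noteq> 0"
    using powser_0_nonzero[of "r / 2" 0 d g k] r g g0 dk by auto
  \<comment> \<open>A positive point that is close enough to 0 for the punctured neighbourhood, the convergence and the hypothesis.\<close>
  define x where "x = min s (r / 4)"
  have x: "0 < x" "x < r" "x < r / 2" "x \<le> s" using s r by (auto simp: x_def)
  have "g x = 0" using d[of x] g[of x] x by (auto intro: sums_unique2)
  then show False using s(2)[of x] x by auto
qed

section \<open>The joint pseudo-distribution of overshooting time and place\<close>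

lemma root_sum_eq_overshoot_gf:
  assumes "1 \<le> N" "0 < c" "0 < z" "z < 1"
  shows "(-1) ^ m * (\<Sum>k=1..N. s_plus N c z k m / p_plus N c z k * u_root N c z k ^ e) =
     overshoot_gf N c e m (of_real z)"
  unfolding s_plus_def p_plus_def overshoot_gf_def u_root_eq_root_cont[OF assms] ..

lemma overshoot_sums_gf:
  assumes "1 \<le> N" "1 \<le> b" "0 < c" "l \<in> {b..b + int N - 1}" "0 < Re z" "Re z < 1"
    and z: "norm z * symbol_bound N c < 1"
  shows "(\<lambda>n. of_real (overshoot_prob N c b (Suc n) l) * z ^ Suc n) sums
     overshoot_gf N c (nat (b + int N - 1)) (nat (l - b)) z"
proof -
  have m: "nat (l - b) < N" "b + int (nat (l - b)) = l" using assms(4) by auto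
  have "summable (\<lambda>n. of_real (overshoot_prob N c b (Suc n) l) * z ^ Suc n)"
    using assms by (intro summable_overshoot) auto
  then show ?thesis
    using overshoot_series_eq_gf[OF assms(1-3,5-6) z m(1)] unfolding m(2) by (simp add: sums_iff)
qed

theorem theorem5p1:
  fixes N :: nat and b l :: int and c :: real
  assumes "N \<ge> 1" and "b \<ge> 1" and "c > 0" and "l \<in> {b..b + int N - 1}"
  shows "let G = (\<lambda>z. (-1) ^ nat (l - b) *
           (\<Sum>k=1..N. s_plus N c z k (nat (l - b)) / p_plus N c z k *
              u_root N c z k ^ nat (b + int N - 1)))
    in (\<forall>z\<in>{0<..<1}. gen_fun (\<lambda>k. overshoot_prob N c b k l) z = G z)
     \<and> (\<forall>z\<in>{0<..<1}. z * (4 ^ N * c - 1) < 1 \<longrightarrow>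
          summable (\<lambda>k. overshoot_prob N c b (Suc k) l * z ^ Suc k))
     \<and> (\<forall>a. (\<exists>r\<in>{0<..1}. \<forall>z\<in>{0<..<r}.
              (\<lambda>k. complex_of_real (a (Suc k) * z ^ Suc k)) sums G z) \<longrightarrow>
          (\<forall>k\<ge>1. a k = overshoot_prob N c b k l))"
proof -
  define F where "F = overshoot_gf N c (nat (b + int N - 1)) (nat (l - b))"
  let ?a = "\<lambda>k. overshoot_prob N c b k l"
  let ?G = "\<lambda>z. (-1) ^ nat (l - b) *
           (\<Sum>k=1..N. s_plus N c z k (nat (l - b)) / p_plus N c z k *
              u_root N c z k ^ nat (b + int N - 1))"
  let ?\<Lambda> = "symbol_bound N c"
  have \<Lambda>: "1 \<le> ?\<Lambda>" by (rule symbol_bound_ge_1)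
  have G: "?G z = F (of_real z)" if "0 < z" "z < 1" for z
    unfolding F_def by (rule root_sum_eq_overshoot_gf) (use assms that in auto)
  have hol: "F holomorphic_on {z. 0 < Re z \<and> Re z < 1}"
    unfolding F_def by (rule holomorphic_on_overshoot_gf) (use assms in auto)
  have sums: "(\<lambda>k. of_real (?a (Suc k)) * z ^ Suc k) sums F z"
    if "norm z * ?\<Lambda> < 1" "0 < Re z" "Re z < 1" for z
    unfolding F_def using assms that by (intro overshoot_sums_gf) auto
  have cont: "continued_value ?a x (F (of_real x))" if "0 < x" "x < 1" for x
  proof (rule continued_value_glue[where \<rho> = "1 / ?\<Lambda>"])
    let ?H = "\<lambda>z. \<Sum>k. complex_of_real (?a (Suc k)) * z ^ Suc k"
    have ball: "norm z * ?\<Lambda> < 1" if "z \<in> ball 0 (1 / ?\<Lambda>)" for z :: complex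
      using that \<Lambda> by (simp add: field_simps)
    show "(\<lambda>k. complex_of_real (?a (Suc k)) * z ^ Suc k) sums ?H z" if "z \<in> ball 0 (1 / ?\<Lambda>)" for z
      using assms ball[OF that] by (intro summable_sums summable_overshoot) auto
    show "?H z = F z" if "z \<in> ball 0 (1 / ?\<Lambda>)" "0 < Re z" "Re z < 1" for z
      using sums[OF ball[OF that(1)] that(2,3)] by (simp add: sums_iff)
  qed (use \<Lambda> that hol in auto)
  have gen: "gen_fun ?a z = ?G z" if z: "z \<in> {0<..<1}" for z
  proof -
    have "isCont F (of_real z)"
      using hol z by (intro holomorphic_on_imp_continuous_on[THEN continuous_on_interior[where x = "of_real z"]])
         (auto simp: interior_open open_Collect_conj open_halfspace_Re_lt open_halfspace_Re_gt)
    then have "((\<lambda>x. F (of_real x)) \<longlongrightarrow> F (of_real z)) (at_left z)"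
      by (rule isCont_tendsto_compose) (intro tendsto_intros)
    then have "gen_fun ?a z = F (of_real z)"
      using z cont by (intro gen_fun_eq_continuation[where F = "\<lambda>x. F (of_real x)"]) auto
    then show ?thesis using G z by simp
  qed
  have summ: "summable (\<lambda>k. ?a (Suc k) * z ^ Suc k)" if z: "z \<in> {0<..<1}" "z * (4 ^ N * c - 1) < 1" for z
  proof -
    have "norm z * ?\<Lambda> < 1" using z by (auto simp: symbol_bound_def max_def)
    then show ?thesis
      using summable_overshoot[of c b l z N] assms by simp
  qed
  have uniq: "a k = ?a k"
    if r: "r \<in> {0<..1}" and a: "\<forall>z\<in>{0<..<r}. (\<lambda>k. complex_of_real (a (Suc k) * z ^ Suc k)) sums ?G z"
      and k: "1 \<le> k" for a r k
  proof (rule powser_coeffs_unique_pos[where r = "min r (1 / ?\<Lambda>)" and f = "\<lambda>z. Re (?G z)"])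
    fix x assume x: "0 < x" "x < min r (1 / ?\<Lambda>)"
    have x1: "x < 1" "x \<in> {0<..<r}" using x r by auto
    show "(\<lambda>k. a (Suc k) * x ^ Suc k) sums Re (?G x)"
      using sums_Re[OF a[rule_format, OF x1(2)]] by simp
    have "norm (complex_of_real x) * ?\<Lambda> < 1" using x \<Lambda> by (simp add: field_simps)
    then have "(\<lambda>k. complex_of_real (?a (Suc k) * x ^ Suc k)) sums ?G x"
      using sums[of "of_real x"] x x1 G[of x] by simp
    from sums_Re[OF this] show "(\<lambda>k. ?a (Suc k) * x ^ Suc k) sums Re (?G x)" by simp
  qed (use r \<Lambda> k in auto)
  show ?thesis
    unfolding Let_def
  proof (intro conjI ballI allI impI)
    fix z :: real assume z: "z \<in> {0<..<1}"
    show "gen_fun ?a z = ?G z" using z by (rule gen)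
    assume "z * (4 ^ N * c - 1) < 1"
    with z show "summable (\<lambda>k. ?a (Suc k) * z ^ Suc k)" by (rule summ)
  next
    fix a :: "nat \<Rightarrow> real" and k :: nat
    assume ex: "\<exists>r\<in>{0<..1}. \<forall>z\<in>{0<..<r}. (\<lambda>k. complex_of_real (a (Suc k) * z ^ Suc k)) sums ?G z"
      and k: "1 \<le> k"
    from ex obtain r where r: "r \<in> {0<..1}"
      "\<forall>z\<in>{0<..<r}. (\<lambda>k. complex_of_real (a (Suc k) * z ^ Suc k)) sums ?G z" by (rule bexE)
    show "a k = ?a k" using r k by (rule uniq)
  qed
qed

end
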